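(* Let $\theta\in\mathbb{R}$, and let $P$ be the projection ($4\times4$ matrix) with entries $P_{ij}=\rho^{-2}\sum_{k,l}A_{ik}(A_{jl})^*\otimes p_{kl}$, with entries in $\mathcal{A}(\mathrm{SL}_\theta(2,\mathbb{H}))\otimes\mathcal{A}(S^4_\theta)$ enlarged by $\rho^{-2}$. The family of connections $\widetilde\nabla:=P\circ(\mathrm{id}\otimes \mathrm{d})$ has self-dual curvature $\widetilde\nabla^2=P((\mathrm{id}\otimes \mathrm{d})P)^2$, that is, $$(\mathrm{id}\otimes *_\theta)\,P((\mathrm{id}\otimes \mathrm{d})P)^2=P((\mathrm{id}\otimes \mathrm{d})P)^2 .$$
   Context: Let $\theta\in\mathbb{R}$, $\mu=e^{\pi \mathrm{i}\theta}$, $\lambda=\mu^2$, and let $\eta=(\eta_{ij})$ be $$\eta=\begin{pmatrix}1&1&\bar\mu&\mu\\1&1&\mu&\bar\mu\\ \mu&\bar\mu&1&1\\ \bar\mu&\mu&1&1\end{pmatrix}.$$ **The group algebra.** $\mathcal{A}(M_\theta(2,\mathbb{H}))$ is the unital complex $*$-algebra generated by the entries of $$A_\theta=(A_{ij})=\begin{pmatrix}a_1&a_2&b_1&b_2\\-a_2^*&a_1^*&-b_2^*&b_1^*\\c_1&c_2&d_1&d_2\\-c_2^*&c_1^*&-d_2^*&d_1^*\end{pmatrix}$$ with relations $A_{ij}A_{kl}=\eta_{ki}\eta_{jl}A_{kl}A_{ij}$. The determinant is $\det(A_\theta)=\sum_{\sigma\in S_4}(-1)^{|\sigma|}\varepsilon^{\sigma(1)\sigma(2)\sigma(3)\sigma(4)}A_{1,\sigma(1)}\cdots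 A_{4,\sigma(4)}$, where $\varepsilon^{ijkl}=\mu$ if $(i,j,k,l)$ is $(1,3,2,4)$ or one of its cyclic rotations, $\bar\mu$ if it is $(1,4,2,3)$ or one of its cyclic rotations, and $1$ for all other permutations; it is central, and $\mathcal{A}(\mathrm{SL}_\theta(2,\mathbb{H}))$ is the quotient by the ideal generated by $\det(A_\theta)-1$. **The sphere.** $\mathcal{A}(S^4_\theta)$ is the unital $*$-algebra generated by a central self-adjoint $x$ and $\alpha,\beta,\alpha^*,\beta^*$ with $\alpha\beta=\lambda\beta\alpha$, $\alpha^*\beta^*=\lambda\beta^*\alpha^*$, $\beta^*\alpha=\lambda\alpha\beta^*$, $\beta\alpha^*=\lambda\alpha^*\beta$, $\alpha,\beta$ normal, and $\alpha^*\alpha+\beta^*\beta+x^2=1$. The basic projection is $$p=(p_{kl})=\tfrac12\begin{pmatrix}1+x&0&\alpha&\beta\\0&1+x&-\mu\beta^*&\bar\mu\alpha^*\\ \alpha^*&-\bar\mu\beta&1-x&0\\ \beta^*&\mu\alpha&0&1-x\end{pmatrix}.$$ **Forms and Hodge operator.** The torus $\mathbb{T}^2$ acts on $S^4$, hence on the algebra $\mathcal{A}(S^4)$ of polynomial functions, by $(x,\alpha,\beta)\mapsto(x,e^{2\pi \mathrm{i}t_1}\alpha,e^{2\pi \mathrm{i}t_2}\beta)$, and on the polynomial differential forms $\Omega(S^4)$. $\Omega(S^4_\theta)$ is the graded vector space $\Omega(S^4)$ with the product given on elements $f_r,g_s$ homogeneous of bidegrees $r,s\in\mathbb{Z}^2$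 by $f_r\times_\theta g_s=e^{\pi \mathrm{i}\theta(r_1s_2-r_2s_1)}f_rg_s$; its degree zero part is $\mathcal{A}(S^4_\theta)$. The differential $\mathrm{d}$ and the Hodge operator $*_\theta$ on $\Omega(S^4_\theta)$ are the undeformed ones (for the round metric) under this identification of vector spaces, with the orientation for which the curvature $p(\mathrm{d}p)^2$ of the basic connection $p\circ \mathrm{d}$ is self-dual: $*_\theta(p(\mathrm{d}p)^2)=p(\mathrm{d}p)^2$. **The family.** Set $\rho^2:=\tfrac12\sum_{i,k,l}\eta_{lk}(A_{il})^*A_{ik}\otimes p_{kl}\in\mathcal{A}(\mathrm{SL}_\theta(2,\mathbb{H}))\otimes\mathcal{A}(S^4_\theta)$; it commutes with all elements $\sum_{k,l}A_{ik}(A_{jl})^*\otimes p_{kl}$ and with their images under $\mathrm{id}\otimes\mathrm{d}$. The algebra is enlarged by adjoining the inverse $\rho^{-2}$ of $\rho^2$. $\mathrm{SL}_\theta(2,\mathbb{H})$ is treated as a parameter space: differential and Hodge operator on $\mathcal{A}(\mathrm{SL}_\theta(2,\mathbb{H}))\otimes\Omega(S^4_\theta)$ are $\mathrm{id}\otimes\mathrm{d}$ and $\mathrm{id}\otimes*_\theta$, extended to the enlarged algebra by $\mathrm{d}(\rho^{-2})=-\rho^{-2}\,\mathrm{d}(\rho^2)\,\rho^{-2}$ and by $*(\rho^{-2k}\omega)=\rho^{-2k}\,(\mathrm{id}\otimes*_\theta)\omega$ for $\omega\in\mathcal{A}(\mathrm{SL}_\theta(2,\mathbb{H}))\otimes\Omega(S^4_\theta)$.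 *)

theory Defs
  imports Complex_Main "HOL-Library.Poly_Mapping" "HOL-Combinatorics.Permutations"
begin

text \<open>
  The algebras depend on the real parameter \<open>\<theta>\<close>, so they cannot be types. Each one is a quotient of
  a complex vector space with a fixed basis, and it is represented by that vector space together
  with the ideal that is divided out: equality in the quotient is membership of the difference in
  the ideal.
\<close>

section \<open>Vector spaces with a basis, free algebras, ideals\<close>

definition csc :: "complex \<Rightarrow> ('k \<Rightarrow>\<^sub>0 complex) \<Rightarrow> ('k \<Rightarrow>\<^sub>0 complex)" where
  "csc c f = Poly_Mapping.map ((*) c) f"

definition lin_ext :: "('k \<Rightarrow> ('m \<Rightarrow>\<^sub>0 complex)) \<Rightarrow> ('k \<Rightarrow>\<^sub>0 complex) \<Rightarrow> ('m \<Rightarrow>\<^sub>0 complex)" where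
  "lin_ext F v = (\<Sum>k\<in>Poly_Mapping.keys v. csc (Poly_Mapping.lookup v k) (F k))"

definition bilin_ext ::
  "('k \<Rightarrow> 'k \<Rightarrow> ('m \<Rightarrow>\<^sub>0 complex)) \<Rightarrow> ('k \<Rightarrow>\<^sub>0 complex) \<Rightarrow> ('k \<Rightarrow>\<^sub>0 complex) \<Rightarrow> ('m \<Rightarrow>\<^sub>0 complex)" where
  "bilin_ext B v w = (\<Sum>k\<in>Poly_Mapping.keys v. \<Sum>l\<in>Poly_Mapping.keys w. csc (Poly_Mapping.lookup v k * Poly_Mapping.lookup w l) (B k l))"

text \<open>
  The free monoid is written additively, so that the convolution product of \<^theory>\<open>HOL-Library.Poly_Mapping\<close>
  makes \<open>'g free_alg\<close> the free unital complex algebra on \<open>'g\<close>.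
\<close>

datatype 'g word = Word (letters: "'g list")

instantiation word :: (type) monoid_add
begin
definition zero_word :: "'a word" where "zero_word = Word []"
definition plus_word :: "'a word \<Rightarrow> 'a word \<Rightarrow> 'a word" where
  "plus_word u v = Word (letters u @ letters v)"
instance
  by standard (simp_all add: zero_word_def plus_word_def)
end

type_synonym 'g free_alg = "'g word \<Rightarrow>\<^sub>0 complex"

definition gen :: "'g \<Rightarrow> 'g free_alg" where
  "gen g = Poly_Mapping.single (Word [g]) 1"

inductive_set two_sided_ideal :: "'a::ring_1 set \<Rightarrow> 'a set" for S :: "'a set" where
  zero: "0 \<in> two_sided_ideal S"
| step: "r \<in> S \<Longrightarrow> y \<in> two_sided_ideal S \<Longrightarrow> a * r * b + y \<in> two_sided_ideal S"


section \<open>The algebra of \<open>SL\<^sub>\<theta>(2,H)\<close>\<close>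

definition mu :: "real \<Rightarrow> complex" where
  "mu \<theta> = exp (of_real (pi * \<theta>) * \<i>)"

definition eta :: "real \<Rightarrow> nat \<Rightarrow> nat \<Rightarrow> complex" where
  "eta \<theta> i j =
    [[1, 1, cnj (mu \<theta>), mu \<theta>],
     [1, 1, mu \<theta>, cnj (mu \<theta>)],
     [mu \<theta>, cnj (mu \<theta>), 1, 1],
     [cnj (mu \<theta>), mu \<theta>, 1, 1]] ! (i - 1) ! (j - 1)"

datatype coeff = Ca1 | Ca2 | Cb1 | Cb2 | Cc1 | Cc2 | Cd1 | Cd2

text \<open>\<open>(c, False)\<close> stands for the generator \<open>c\<close> and \<open>(c, True)\<close> for its adjoint.\<close>

type_synonym sl_free = "(coeff \<times> bool) free_alg"

definition unst :: "coeff \<Rightarrow> sl_free" where "unst c = gen (c, False)"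
definition st :: "coeff \<Rightarrow> sl_free" where "st c = gen (c, True)"

definition sl_adj :: "sl_free \<Rightarrow> sl_free" where
  "sl_adj f = (\<Sum>w\<in>Poly_Mapping.keys f.
     Poly_Mapping.single (Word (rev (map (\<lambda>(c, b). (c, \<not> b)) (letters w)))) (cnj (Poly_Mapping.lookup f w)))"

definition Amat :: "nat \<Rightarrow> nat \<Rightarrow> sl_free" where
  "Amat i j =
    [[unst Ca1, unst Ca2, unst Cb1, unst Cb2],
     [- st Ca2, st Ca1, - st Cb2, st Cb1],
     [unst Cc1, unst Cc2, unst Cd1, unst Cd2],
     [- st Cc2, st Cc1, - st Cd2, st Cd1]] ! (i - 1) ! (j - 1)"

definition det_eps :: "real \<Rightarrow> nat list \<Rightarrow> complex" where
  "det_eps \<theta> js =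
    (if \<exists>n. js = rotate n [1, 3, 2, 4] then mu \<theta>
     else if \<exists>n. js = rotate n [1, 4, 2, 3] then cnj (mu \<theta>)
     else 1)"

definition Adet :: "real \<Rightarrow> sl_free" where
  "Adet \<theta> = (\<Sum>\<sigma>\<in>{\<sigma>. \<sigma> permutes {1..4}}.
     csc (of_int (sign \<sigma>) * det_eps \<theta> [\<sigma> 1, \<sigma> 2, \<sigma> 3, \<sigma> 4])
       (Amat 1 (\<sigma> 1) * Amat 2 (\<sigma> 2) * Amat 3 (\<sigma> 3) * Amat 4 (\<sigma> 4)))"

text \<open>
  The adjoint of each commutation relation is, up to a scalar, again one of them (the adjoint of an
  entry is up to sign the entry with both indices changed by 1-2, 3-4, under which \<open>eta\<close> is
  invariant), so the ideal generated by them is automatically closed under \<open>sl_adj\<close>.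
\<close>

definition M_rel :: "real \<Rightarrow> sl_free set" where
  "M_rel \<theta> =
    {Amat i j * Amat k l - csc (eta \<theta> k i * eta \<theta> j l) (Amat k l * Amat i j) | i j k l.
       i \<in> {1..4} \<and> j \<in> {1..4} \<and> k \<in> {1..4} \<and> l \<in> {1..4}}"

definition SL_ideal :: "real \<Rightarrow> sl_free set" where
  "SL_ideal \<theta> = two_sided_ideal (M_rel \<theta> \<union> {Adet \<theta> - 1})"


section \<open>Polynomial differential forms on the four-sphere\<close>

text \<open>
  Complex coordinates \<open>x, \<alpha>, \<alpha>\<^sup>*, \<beta>, \<beta>\<^sup>*\<close> on \<open>R\<^sup>5\<close>. Polynomial forms on \<open>R\<^sup>5\<close> have as basis the monomials
  \<open>z\<^sup>m dz\<^sub>S\<close>, encoded as \<open>(m, S)\<close>, where \<open>dz\<^sub>S\<close> is the product of the differentials in \<open>S\<close> in the order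
  listed here.
\<close>

datatype coord = X | Al | Als | Be | Bes

definition coords :: "coord list" where
  "coords = [X, Al, Als, Be, Bes]"

primrec cidx :: "coord \<Rightarrow> nat" where
  "cidx X = 0" | "cidx Al = 1" | "cidx Als = 2" | "cidx Be = 3" | "cidx Bes = 4"

primrec cbar :: "coord \<Rightarrow> coord" where
  "cbar X = X" | "cbar Al = Als" | "cbar Als = Al" | "cbar Be = Bes" | "cbar Bes = Be"

type_synonym fmono = "(coord \<Rightarrow> nat) \<times> coord set"
type_synonym form = "fmono \<Rightarrow>\<^sub>0 complex"

definition fone :: form where
  "fone = Poly_Mapping.single (\<lambda>_. 0, {}) 1"

definition var :: "coord \<Rightarrow> form" where
  "var c = Poly_Mapping.single ((\<lambda>_. 0)(c := 1), {}) 1"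

definition wedge_mono :: "fmono \<Rightarrow> fmono \<Rightarrow> form" where
  "wedge_mono k l =
    (if snd k \<inter> snd l = {}
     then Poly_Mapping.single (\<lambda>c. fst k c + fst l c, snd k \<union> snd l)
            ((- 1) ^ card {(a, b). a \<in> snd k \<and> b \<in> snd l \<and> cidx b < cidx a})
     else 0)"

definition wedge :: "form \<Rightarrow> form \<Rightarrow> form" where
  "wedge = bilin_ext wedge_mono"

definition dform :: "form \<Rightarrow> form" where
  "dform = lin_ext (\<lambda>(m, S). \<Sum>c\<leftarrow>coords.
     csc (of_nat (m c)) (wedge_mono (m(c := m c - 1), {c}) (\<lambda>_. 0, S)))"

definition fgrade :: "form \<Rightarrow> form" where
  "fgrade = lin_ext (\<lambda>(m, S). Poly_Mapping.single (m, S) ((- 1) ^ card S))"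

text \<open>
  Forms on the sphere are forms on \<open>R\<^sup>5\<close> modulo the ideal generated by \<open>r\<^sup>2 - 1\<close> and \<open>r dr\<close>. This ideal
  consists of the forms whose restriction (pull-back) to the sphere vanishes.
\<close>

definition rsq :: form where
  "rsq = wedge (var X) (var X) + wedge (var Al) (var Als) + wedge (var Be) (var Bes)"

definition rdr :: form where
  "rdr = csc (1 / 2) (dform rsq)"

definition sphere_ideal :: "form set" where
  "sphere_ideal = {wedge (rsq - fone) \<omega> + wedge rdr \<tau> | \<omega> \<tau>. True}"

primrec bideg_coord :: "coord \<Rightarrow> int \<times> int" where
  "bideg_coord X = (0, 0)"
| "bideg_coord Al = (1, 0)"
| "bideg_coord Als = (-1, 0)"
| "bideg_coord Be = (0, 1)"
| "bideg_coord Bes = (0, -1)"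

definition bideg :: "fmono \<Rightarrow> int \<times> int" where
  "bideg k =
    (let mult = (\<lambda>c. int (fst k c) + (if c \<in> snd k then 1 else 0))
     in (\<Sum>c\<leftarrow>coords. mult c * fst (bideg_coord c), \<Sum>c\<leftarrow>coords. mult c * snd (bideg_coord c)))"

definition twist :: "real \<Rightarrow> int \<times> int \<Rightarrow> int \<times> int \<Rightarrow> complex" where
  "twist \<theta> r s = exp (of_real (pi * \<theta> * of_int (fst r * snd s - snd r * fst s)) * \<i>)"

text \<open>
  The deformed product. The ideal of the sphere is spanned by elements homogeneous for the
  bidegree, so it is an ideal for this product as well.
\<close>

definition tprod :: "real \<Rightarrow> form \<Rightarrow> form \<Rightarrow> form" where
  "tprod \<theta> = bilin_ext (\<lambda>k l. csc (twist \<theta> (bideg k) (bideg l)) (wedge_mono k l))"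

text \<open>
  The Euclidean metric, extended complex bilinearly to the coordinate differentials, pairs \<open>dz\<^sub>c\<close> only
  with \<open>dz\<^bsub>cbar c\<^esub>\<close>, with value 1 for \<open>x\<close> and 2 otherwise. \<open>contract c\<close> is the interior product with the
  vector dual to \<open>dz\<^sub>c\<close>.
\<close>

definition contract :: "coord \<Rightarrow> form \<Rightarrow> form" where
  "contract c = lin_ext (\<lambda>(m, S).
     if cbar c \<in> S
     then Poly_Mapping.single (m, S - {cbar c})
            ((if c = X then 1 else 2) * (- 1) ^ card {b \<in> S. cidx b < cidx (cbar c)})
     else 0)"

text \<open>
  The Hodge operator of \<open>R\<^sup>5\<close> sends \<open>v\<^sub>1 \<and> \<dots> \<and> v\<^sub>k\<close> to the volume form contracted with the dual of \<open>v\<^sub>1\<close>,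
  then of \<open>v\<^sub>2\<close>, and so on. The volume form \<open>dx dy\<^sub>1 dy\<^sub>2 dy\<^sub>3 dy\<^sub>4\<close> with \<open>\<alpha> = y\<^sub>1 + i y\<^sub>2\<close>, \<open>\<beta> = y\<^sub>3 + i y\<^sub>4\<close> is
  \<open>-1/4 dx d\<alpha> d\<alpha>\<^sup>* d\<beta> d\<beta>\<^sup>*\<close>.
\<close>

definition hodge_R5 :: "form \<Rightarrow> form" where
  "hodge_R5 = lin_ext (\<lambda>(m, S).
     fold contract (filter (\<lambda>c. c \<in> S) coords) (Poly_Mapping.single (m, set coords) (- (1 / 4))))"

text \<open>
  The Hodge operator of the round sphere, which is the one of \<open>R\<^sup>5\<close> applied to the product with the
  unit conormal \<open>dr\<close> (equal to \<open>r dr\<close> on the sphere). The sign \<open>s\<close> is the choice of orientation: \<open>s = 1\<close>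
  is the boundary orientation of the unit ball, \<open>s = -1\<close> the opposite one.
\<close>

definition hodge :: "complex \<Rightarrow> form \<Rightarrow> form" where
  "hodge s \<omega> = csc s (hodge_R5 (wedge rdr \<omega>))"

definition pmat :: "real \<Rightarrow> nat \<Rightarrow> nat \<Rightarrow> form" where
  "pmat \<theta> k l = csc (1 / 2)
    ([[fone + var X, 0, var Al, var Be],
      [0, fone + var X, csc (- mu \<theta>) (var Bes), csc (cnj (mu \<theta>)) (var Als)],
      [var Als, csc (- cnj (mu \<theta>)) (var Be), fone - var X, 0],
      [var Bes, csc (mu \<theta>) (var Al), 0, fone - var X]] ! (k - 1) ! (l - 1))"

definition basic_curv :: "real \<Rightarrow> nat \<Rightarrow> nat \<Rightarrow> form" where
  "basic_curv \<theta> i l = (\<Sum>j=1..4. \<Sum>k=1..4.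
     tprod \<theta> (tprod \<theta> (pmat \<theta> i j) (dform (pmat \<theta> j k))) (dform (pmat \<theta> k l)))"

definition basic_curv_selfdual :: "real \<Rightarrow> complex \<Rightarrow> bool" where
  "basic_curv_selfdual \<theta> s \<longleftrightarrow> (\<forall>i\<in>{1..4}. \<forall>l\<in>{1..4}.
     hodge s (basic_curv \<theta> i l) - basic_curv \<theta> i l \<in> sphere_ideal)"


section \<open>The tensor product with \<open>\<rho>\<^sup>2\<close> inverted\<close>

text \<open>
  The algebra generated by the pure tensors \<open>a \<otimes> \<omega>\<close> and one further generator, subject to the
  defining relations of the tensor product of the two algebras and to the relations making the
  further generator a two-sided inverse of \<open>\<rho>\<^sup>2\<close>. As \<open>\<rho>\<^sup>2\<close> is not central, the inverse is adjoined
  freely otherwise.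
\<close>

datatype egen = Pure sl_free form | RhoInv

type_synonym eelem = "egen free_alg"

definition ten :: "sl_free \<Rightarrow> form \<Rightarrow> eelem" where
  "ten a \<omega> = gen (Pure a \<omega>)"

definition rhoinv :: eelem where
  "rhoinv = gen RhoInv"

definition rho2_with :: "real \<Rightarrow> (form \<Rightarrow> form) \<Rightarrow> eelem" where
  "rho2_with \<theta> D = csc (1 / 2) (\<Sum>i=1..4. \<Sum>k=1..4. \<Sum>l=1..4.
     csc (eta \<theta> l k) (ten (sl_adj (Amat i l) * Amat i k) (D (pmat \<theta> k l))))"

definition rho2 :: "real \<Rightarrow> eelem" where
  "rho2 \<theta> = rho2_with \<theta> (\<lambda>\<omega>. \<omega>)"

definition drho2 :: "real \<Rightarrow> eelem" where
  "drho2 \<theta> = rho2_with \<theta> dform"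

definition E_rel :: "real \<Rightarrow> eelem set" where
  "E_rel \<theta> =
     {ten (csc c a + b) \<omega> - csc c (ten a \<omega>) - ten b \<omega> | c a b \<omega>. True}
   \<union> {ten a (csc c \<omega> + \<tau>) - csc c (ten a \<omega>) - ten a \<tau> | c a \<omega> \<tau>. True}
   \<union> {ten a \<omega> | a \<omega>. a \<in> SL_ideal \<theta>}
   \<union> {ten a \<omega> | a \<omega>. \<omega> \<in> sphere_ideal}
   \<union> {ten a \<omega> * ten b \<tau> - ten (a * b) (tprod \<theta> \<omega> \<tau>) | a b \<omega> \<tau>. True}
   \<union> {ten 1 fone - 1}
   \<union> {rhoinv * rho2 \<theta> - 1, rho2 \<theta> * rhoinv - 1}"

definition E_eq :: "real \<Rightarrow> eelem \<Rightarrow> eelem \<Rightarrow> bool" where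
  "E_eq \<theta> u v \<longleftrightarrow> u - v \<in> two_sided_ideal (E_rel \<theta>)"

primrec grade_gen :: "egen \<Rightarrow> eelem" where
  "grade_gen (Pure a \<omega>) = ten a (fgrade \<omega>)"
| "grade_gen RhoInv = rhoinv"

primrec d_gen :: "real \<Rightarrow> egen \<Rightarrow> eelem" where
  "d_gen \<theta> (Pure a \<omega>) = ten a (dform \<omega>)"
| "d_gen \<theta> RhoInv = - (rhoinv * drho2 \<theta> * rhoinv)"

primrec d_letters :: "real \<Rightarrow> egen list \<Rightarrow> eelem" where
  "d_letters \<theta> [] = 0"
| "d_letters \<theta> (g # gs) =
     d_gen \<theta> g * Poly_Mapping.single (Word gs) 1 + grade_gen g * d_letters \<theta> gs"

text \<open>The differential \<open>id \<otimes> d\<close>, extended to \<open>\<rho>\<^sup>-\<^sup>2\<close> as a graded derivation.\<close>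

definition dE :: "real \<Rightarrow> eelem \<Rightarrow> eelem" where
  "dE \<theta> = lin_ext (\<lambda>w. d_letters \<theta> (letters w))"

text \<open>
  \<open>hodge_E \<theta> s u v\<close> says that the image of \<open>u\<close> under the extended Hodge operator is \<open>v\<close>. The extension
  rule only concerns the elements \<open>\<rho>\<^sup>-\<^sup>2\<^sup>k \<omega>\<close> with \<open>\<omega> = \<Sum>\<^sub>r a\<^sub>r \<otimes> \<omega>\<^sub>r\<close> in the tensor product, and not all
  elements are of this form, so the operator is given by its graph; every operator that satisfies
  the rule maps \<open>u\<close> to \<open>v\<close> whenever \<open>hodge_E \<theta> s u v\<close>.
  The graph is single-valued up to \<open>E_eq\<close>, because the Hodge operator on the tensor product commutes with left
  multiplication by \<open>\<rho>\<^sup>2\<close> and the tensor product embeds into the enlarged algebra (not proved here).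
\<close>

definition hodge_E :: "real \<Rightarrow> complex \<Rightarrow> eelem \<Rightarrow> eelem \<Rightarrow> bool" where
  "hodge_E \<theta> s u v \<longleftrightarrow> (\<exists>k n a \<omega>.
     E_eq \<theta> u (rhoinv ^ k * (\<Sum>r<(n::nat). ten (a r) (\<omega> r))) \<and>
     E_eq \<theta> v (rhoinv ^ k * (\<Sum>r<n. ten (a r) (hodge s (\<omega> r)))))"


section \<open>The family of connections\<close>

definition Pmat :: "real \<Rightarrow> nat \<Rightarrow> nat \<Rightarrow> eelem" where
  "Pmat \<theta> i j = rhoinv * (\<Sum>k=1..4. \<Sum>l=1..4. ten (Amat i k * sl_adj (Amat j l)) (pmat \<theta> k l))"

definition nabla :: "real \<Rightarrow> (nat \<Rightarrow> eelem) \<Rightarrow> (nat \<Rightarrow> eelem)" where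
  "nabla \<theta> \<psi> i = (\<Sum>j=1..4. Pmat \<theta> i j * dE \<theta> (\<psi> j))"

definition curv :: "real \<Rightarrow> nat \<Rightarrow> nat \<Rightarrow> eelem" where
  "curv \<theta> i l = (\<Sum>j=1..4. \<Sum>k=1..4. Pmat \<theta> i j * dE \<theta> (Pmat \<theta> j k) * dE \<theta> (Pmat \<theta> k l))"

definition P_section :: "real \<Rightarrow> (nat \<Rightarrow> eelem) \<Rightarrow> bool" where
  "P_section \<theta> \<psi> \<longleftrightarrow> (\<forall>i\<in>{1..4}. E_eq \<theta> (\<Sum>j=1..4. Pmat \<theta> i j * \<psi> j) (\<psi> i))"

end

theory Submission
  imports Defs
begin

text \<open>
  Write \<open>e = dp\<close>, \<open>H = A\<^sup>* A\<close>, \<open>Q = A p A\<^sup>*\<close>, \<open>r = \<rho>\<^sup>2\<close>, so that \<open>P = r\<^sup>-\<^sup>1 Q\<close>. Up to phases that come from the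
  twist, the entries commute, \<open>p H p = r p\<close>, and Cayley-Hamilton for quaternionic hermitian \<open>2 \<times> 2\<close>
  matrices gives \<open>H p H = r H - \<xi> (1 - p)\<close> with the central element \<open>\<xi> = det H\<close>. Hence \<open>Q\<^sup>2 = r Q\<close>, and as \<open>r\<close> and
  \<open>dr\<close> (graded) commute with \<open>Q\<close> and \<open>dQ\<close>, the curvature is \<open>r\<^sup>-\<^sup>3 (Q dQ dQ - dr Q dQ)\<close>. Differentiating
  \<open>A p H p = r A p\<close> and inserting the second identity turns this into \<open>r\<^sup>-\<^sup>3 \<xi> A (p e e) A\<^sup>*\<close>, whose
  form part is the curvature of the basic connection.
\<close>

text \<open>The obstacle is that products commute only up to powers of \<open>mu \<theta>\<close>.
  Their exponents are determinants of torus weights: each matrix index carries a half-integral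
  spinor weight, \<open>eta\<close> is a bicharacter of two such weights, and the bidegree of
  \<open>pmat \<theta> k l\<close> is the difference of the weights of k and l. Exponents therefore
  add under products and cancel along contracted indices. This is why r and dr commute in the graded
  sense with Q and dQ, although r does not commute with A p.

  The first matrix identity reflects that p projects onto a quaternionic line, so that compressing H
  by p leaves one scalar. Both identities are checked entry by entry, after the quaternionic
  symmetry has reduced H to six independent entries.

  Calculating with equations instead of congruences requires types, hence families over all
  \<theta>; for this the differential has to respect the ideal of relations. The Hodge operator acts
  only on the form factor, so once the curvature is a power of the inverse of r times a sum of
  tensors with entries of the basic curvature as form factors, the assumed self-duality carries
  over.\<close>

lemma lookup_csc [simp]: "Poly_Mapping.lookup (csc c f) k = c * Poly_Mapping.lookup f k"
  by (simp add: csc_def Poly_Mapping.map.rep_eq when_def)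

lemma csc_simps [simp]:
  "csc c 0 = 0" "csc 0 f = 0" "csc 1 f = f" "csc c (csc d f) = csc (c * d) f"
  "csc c (Poly_Mapping.single k d) = Poly_Mapping.single k (c * d)"
  "csc c (- f) = - csc c f" "csc (- c) f = - csc c f"
  by (auto intro!: poly_mapping_eqI simp: lookup_single when_def)

lemma csc_add: "csc c (f + g) = csc c f + csc c g"
  by (auto intro!: poly_mapping_eqI simp: lookup_add algebra_simps)

lemma csc_add_left: "csc (c + d) f = csc c f + csc d f"
  by (auto intro!: poly_mapping_eqI simp: lookup_add algebra_simps)

lemma csc_diff: "csc c (f - g) = csc c f - csc c g"
  by (rule poly_mapping_eqI) (simp add: lookup_minus algebra_simps)

lemma csc_sum: "csc c (sum f A) = (\<Sum>x\<in>A. csc c (f x))"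
  by (induction A rule: infinite_finite_induct) (simp_all add: csc_add)

lemma csc_mult_left: "csc c f * g = csc c (f * (g :: 'g free_alg))"
  by (simp add: csc_def mult_map_scale_conv_mult mult.assoc)

lemma poly_mapping_single_induct [case_names zero add]:
  assumes "P 0" "\<And>f k c. P f \<Longrightarrow> P (f + Poly_Mapping.single k c)"
  shows "P (f :: 'k \<Rightarrow>\<^sub>0 complex)"
proof (induction f rule: update_induct)
  case const
  then show ?case using assms(1) by simp
next
  case (update f a b)
  have "Poly_Mapping.update a b f = f + Poly_Mapping.single a b"
    using update by (auto intro!: poly_mapping_eqI simp: lookup_update lookup_add lookup_single
        when_def in_keys_iff)
  then show ?case using update assms(2) by simp
qed

lemma single_zero_commute: "Poly_Mapping.single 0 c * f = f * Poly_Mapping.single 0 (c::complex)"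
  for f :: "'g free_alg"
  by (induction f rule: poly_mapping_single_induct) (simp_all add: algebra_simps mult_single)

lemma csc_mult_right: "f * csc c g = csc c (f * (g :: 'g free_alg))"
  by (metis csc_def mult_map_scale_conv_mult mult.assoc single_zero_commute)

section \<open>Linear and bilinear extension from a basis\<close>

lemma lin_ext_alt:
  assumes "finite K" "Poly_Mapping.keys v \<subseteq> K"
  shows "lin_ext F v = (\<Sum>k\<in>K. csc (Poly_Mapping.lookup v k) (F k))"
  unfolding lin_ext_def using assms by (intro sum.mono_neutral_left) (auto simp: in_keys_iff)

lemma lin_ext_zero [simp]: "lin_ext F 0 = 0"
  by (simp add: lin_ext_def)

lemma lin_ext_single [simp]: "lin_ext F (Poly_Mapping.single k c) = csc c (F k)"
  by (simp add: lin_ext_def)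

lemma lin_ext_add: "lin_ext F (v + w) = lin_ext F v + lin_ext F w"
proof -
  let ?K = "Poly_Mapping.keys v \<union> Poly_Mapping.keys w"
  have "finite ?K" "Poly_Mapping.keys (v + w) \<subseteq> ?K"
    using Poly_Mapping.keys_add[of v w] by auto
  then show ?thesis
    by (simp add: lin_ext_alt[of ?K] lookup_add csc_add_left sum.distrib)
qed

lemma lin_ext_csc: "lin_ext F (csc c v) = csc c (lin_ext F v)"
proof -
  have "Poly_Mapping.keys (csc c v) \<subseteq> Poly_Mapping.keys v"
    by (auto simp: in_keys_iff)
  then show ?thesis
    by (simp add: lin_ext_alt[of "Poly_Mapping.keys v"] csc_sum)
qed

lemma lin_ext_uminus: "lin_ext F (- v) = - lin_ext F v"
  using lin_ext_csc[of F "-1" v] by simp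

lemma lin_ext_diff: "lin_ext F (v - w) = lin_ext F v - lin_ext F w"
  using lin_ext_add[of F v "- w"] by (simp add: lin_ext_uminus)

lemma lin_ext_sum: "lin_ext F (sum f A) = (\<Sum>x\<in>A. lin_ext F (f x))"
  by (induction A rule: infinite_finite_induct) (simp_all add: lin_ext_add)

lemma bilin_ext_eq: "bilin_ext B v w = lin_ext (\<lambda>k. lin_ext (B k) w) v"
  by (simp add: bilin_ext_def lin_ext_def csc_sum)

lemma bilin_ext_eq': "bilin_ext B v w = lin_ext (\<lambda>l. lin_ext (\<lambda>k. B k l) v) w"
  unfolding bilin_ext_def lin_ext_def csc_sum
  by (subst sum.swap) (simp add: mult.commute)

lemma bilin_ext_zero [simp]: "bilin_ext B 0 w = 0" "bilin_ext B v 0 = 0"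
  by (simp_all add: bilin_ext_def)

lemma bilin_ext_single [simp]:
  "bilin_ext B (Poly_Mapping.single k c) (Poly_Mapping.single l d) = csc (c * d) (B k l)"
  by (simp add: bilin_ext_eq)

lemma bilin_ext_add_left: "bilin_ext B (u + v) w = bilin_ext B u w + bilin_ext B v w"
  and bilin_ext_csc_left: "bilin_ext B (csc c v) w = csc c (bilin_ext B v w)"
  and bilin_ext_diff_left: "bilin_ext B (u - v) w = bilin_ext B u w - bilin_ext B v w"
  and bilin_ext_sum_left: "bilin_ext B (sum f A) w = (\<Sum>x\<in>A. bilin_ext B (f x) w)"
  by (simp_all add: bilin_ext_eq lin_ext_add lin_ext_csc lin_ext_diff lin_ext_sum)

lemma bilin_ext_add_right: "bilin_ext B v (u + w) = bilin_ext B v u + bilin_ext B v w"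
  and bilin_ext_csc_right: "bilin_ext B v (csc c w) = csc c (bilin_ext B v w)"
  and bilin_ext_diff_right: "bilin_ext B v (u - w) = bilin_ext B v u - bilin_ext B v w"
  and bilin_ext_sum_right: "bilin_ext B v (sum f A) = (\<Sum>x\<in>A. bilin_ext B v (f x))"
  by (simp_all add: bilin_ext_eq' lin_ext_add lin_ext_csc lin_ext_diff lin_ext_sum)

section \<open>Signs and bidegrees of monomial forms\<close>

definition ninv :: "coord set \<Rightarrow> coord set \<Rightarrow> nat" where
  "ninv S T = card {(a, b). a \<in> S \<and> b \<in> T \<and> cidx b < cidx a}"

lemma UNIV_coord: "(UNIV :: coord set) = {X, Al, Als, Be, Bes}"
  using coord.exhaust by auto

instance coord :: finite
  by standard (simp add: UNIV_coord)

lemma sum_coords: "(\<Sum>c\<leftarrow>coords. f c) = (\<Sum>c\<in>UNIV. f c :: 'a :: comm_monoid_add)"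
  by (simp add: coords_def UNIV_coord add.assoc)

lemma cidx_inject [simp]: "cidx a = cidx b \<longleftrightarrow> a = b"
  by (cases a; cases b) simp_all

lemma ninv_Un_left: "S \<inter> S' = {} \<Longrightarrow> ninv (S \<union> S') T = ninv S T + ninv S' T"
  unfolding ninv_def by (subst card_Un_disjoint [symmetric]) (auto intro!: arg_cong[where f=card])

lemma ninv_Un_right: "T \<inter> T' = {} \<Longrightarrow> ninv S (T \<union> T') = ninv S T + ninv S T'"
  unfolding ninv_def by (subst card_Un_disjoint [symmetric]) (auto intro!: arg_cong[where f=card])

lemma ninv_empty [simp]: "ninv {} T = 0" "ninv S {} = 0"
  by (simp_all add: ninv_def)

lemma ninv_insert_left: "c \<notin> S \<Longrightarrow> ninv (insert c S) T = ninv {c} T + ninv S T"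
  using ninv_Un_left[of "{c}" S T] by simp

lemma ninv_insert_right: "c \<notin> T \<Longrightarrow> ninv S (insert c T) = ninv S {c} + ninv S T"
  using ninv_Un_right[of "{c}" T S] by simp

text \<open>For disjoint sets every pair in S x T is an inversion in exactly one of the two orders.
  This yields the sign (-1)^(card S * card T) of graded commutativity.\<close>

lemma ninv_swap:
  assumes "S \<inter> T = {}"
  shows "ninv S T + ninv T S = card S * card T"
proof -
  have "ninv T S = card ((\<lambda>(a, b). (b, a)) ` {(a, b). a \<in> T \<and> b \<in> S \<and> cidx b < cidx a})"
    unfolding ninv_def by (rule card_image [symmetric]) (auto simp: inj_on_def)
  also have "(\<lambda>(a, b). (b, a)) ` {(a, b). a \<in> T \<and> b \<in> S \<and> cidx b < cidx a}
      = {(a, b). a \<in> S \<and> b \<in> T \<and> cidx a < cidx b}"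
    by force
  finally have "ninv S T + ninv T S = card ({(a, b). a \<in> S \<and> b \<in> T \<and> cidx b < cidx a}
      \<union> {(a, b). a \<in> S \<and> b \<in> T \<and> cidx a < cidx b})"
    unfolding ninv_def by (subst card_Un_disjoint) auto
  also have "\<dots> = card (S \<times> T)"
  proof (intro arg_cong[where f=card] equalityI subsetI)
    fix x assume "x \<in> S \<times> T"
    moreover from this have "cidx (fst x) \<noteq> cidx (snd x)"
      using assms by auto
    ultimately show "x \<in> {(a, b). a \<in> S \<and> b \<in> T \<and> cidx b < cidx a} \<union> {(a, b). a \<in> S \<and> b \<in> T \<and> cidx a < cidx b}"
      by (cases x) (simp add: nat_neq_iff del: cidx_inject, blast)
  qed auto
  finally show ?thesis
    by (simp add: card_cartesian_product)
qed

lemma wedge_mono_eq: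
  "wedge_mono (m, S) (n, T) =
    (if S \<inter> T = {} then Poly_Mapping.single (\<lambda>c. m c + n c, S \<union> T) ((- 1) ^ ninv S T) else 0)"
  by (simp add: wedge_mono_def ninv_def)

lemma wedge_mono_commute:
  "wedge_mono (m, S) (n, T) = csc ((- 1) ^ (card S * card T)) (wedge_mono (n, T) (m, S))"
proof (cases "S \<inter> T = {}")
  case True
  have "(- 1 :: complex) ^ ninv S T = (- 1) ^ (card S * card T) * (- 1) ^ ninv T S"
    unfolding ninv_swap[OF True, symmetric] by (simp add: power_add flip: power_mult_distrib)
  with True show ?thesis
    by (simp add: wedge_mono_eq add.commute Un_commute Int_commute)
qed (simp add: wedge_mono_eq Int_commute)

lemma twist_simps [simp]:
  "twist \<theta> (0, 0) r = 1" "twist \<theta> r (0, 0) = 1" "twist 0 r t = 1"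
  by (simp_all add: twist_def)

lemma bideg_eq:
  "bideg (m, S) = ((\<Sum>c\<in>UNIV. (int (m c) + of_bool (c \<in> S)) * fst (bideg_coord c)),
                   (\<Sum>c\<in>UNIV. (int (m c) + of_bool (c \<in> S)) * snd (bideg_coord c)))"
  by (simp add: bideg_def sum_coords of_bool_def Let_def)

lemma bideg_one [simp]: "bideg (\<lambda>_. 0, {}) = (0, 0)"
  by (simp add: bideg_eq)

text \<open>Replacing a factor z_c by dz_c keeps the weight, so the twist cannot see the
  differential. The condition on \<open>m c\<close> excludes the truncated subtraction 0 - 1; that
  term of the differential has coefficient 0 anyway.\<close>

lemma bideg_dterm:
  assumes "c \<notin> S" "m c \<noteq> 0"
  shows "bideg (m(c := m c - 1), insert c S) = bideg (m, S)"
proof -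
  have "int ((m(c := m c - 1)) b) + of_bool (b \<in> insert c S) = int (m b) + of_bool (b \<in> S)" for b
    using assms by auto
  then show ?thesis
    by (simp only: bideg_eq)
qed

section \<open>The deformed product and the differential\<close>

lemma tprod_single:
  "tprod \<theta> (Poly_Mapping.single k a) (Poly_Mapping.single l b) =
    csc (a * b * twist \<theta> (bideg k) (bideg l)) (wedge_mono k l)"
  by (simp add: tprod_def)

lemmas tprod_linear =
  bilin_ext_add_left[of "\<lambda>k l. csc (twist \<theta> (bideg k) (bideg l)) (wedge_mono k l)" for \<theta>, folded tprod_def]
  bilin_ext_csc_left[of "\<lambda>k l. csc (twist \<theta> (bideg k) (bideg l)) (wedge_mono k l)" for \<theta>, folded tprod_def]
  bilin_ext_diff_left[of "\<lambda>k l. csc (twist \<theta> (bideg k) (bideg l)) (wedge_mono k l)" for \<theta>, folded tprod_def]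
  bilin_ext_sum_left[of "\<lambda>k l. csc (twist \<theta> (bideg k) (bideg l)) (wedge_mono k l)" for \<theta>, folded tprod_def]
  bilin_ext_add_right[of "\<lambda>k l. csc (twist \<theta> (bideg k) (bideg l)) (wedge_mono k l)" for \<theta>, folded tprod_def]
  bilin_ext_csc_right[of "\<lambda>k l. csc (twist \<theta> (bideg k) (bideg l)) (wedge_mono k l)" for \<theta>, folded tprod_def]
  bilin_ext_diff_right[of "\<lambda>k l. csc (twist \<theta> (bideg k) (bideg l)) (wedge_mono k l)" for \<theta>, folded tprod_def]
  bilin_ext_sum_right[of "\<lambda>k l. csc (twist \<theta> (bideg k) (bideg l)) (wedge_mono k l)" for \<theta>, folded tprod_def]

lemma tprod_zero [simp]: "tprod \<theta> 0 w = 0" "tprod \<theta> v 0 = 0"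
  by (simp_all add: tprod_def)

text \<open>Treating the undeformed product as the case \<theta> = 0 makes every rule for
  \<open>tprod\<close> available for \<open>sphere_ideal\<close> and \<open>rsq\<close>, which are
  defined with \<open>wedge\<close>.\<close>

lemma wedge_eq_tprod: "wedge = tprod 0"
  by (simp add: wedge_def tprod_def fun_eq_iff)

definition dterm :: "(coord \<Rightarrow> nat) \<Rightarrow> coord set \<Rightarrow> coord \<Rightarrow> form" where
  "dterm m S c = (if c \<in> S then 0 else
     Poly_Mapping.single (m(c := m c - 1), insert c S) (of_nat (m c) * (- 1) ^ ninv {c} S))"

lemma dform_single: "dform (Poly_Mapping.single (m, S) a) = csc a (\<Sum>c\<in>UNIV. dterm m S c)"
  unfolding dform_def
  unfolding sum_coords lin_ext_single prod.case wedge_mono_eq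
  by (intro arg_cong[where f="csc a"] sum.cong refl) (simp add: dterm_def fun_upd_def)

lemma fgrade_single [simp]:
  "fgrade (Poly_Mapping.single (m, S) a) = Poly_Mapping.single (m, S) (a * (- 1) ^ card S)"
  by (simp add: fgrade_def)

lemma dform_zero [simp]: "dform 0 = 0" and fgrade_zero [simp]: "fgrade 0 = 0"
  by (simp_all add: dform_def fgrade_def)

lemmas dform_linear = lin_ext_add[of "\<lambda>(m, S). \<Sum>c\<leftarrow>coords.
     csc (of_nat (m c)) (wedge_mono (m(c := m c - 1), {c}) (\<lambda>_. 0, S))", folded dform_def]
   lin_ext_csc[of "\<lambda>(m, S). \<Sum>c\<leftarrow>coords.
     csc (of_nat (m c)) (wedge_mono (m(c := m c - 1), {c}) (\<lambda>_. 0, S))", folded dform_def]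
   lin_ext_diff[of "\<lambda>(m, S). \<Sum>c\<leftarrow>coords.
     csc (of_nat (m c)) (wedge_mono (m(c := m c - 1), {c}) (\<lambda>_. 0, S))", folded dform_def]
   lin_ext_sum[of "\<lambda>(m, S). \<Sum>c\<leftarrow>coords.
     csc (of_nat (m c)) (wedge_mono (m(c := m c - 1), {c}) (\<lambda>_. 0, S))", folded dform_def]
   lin_ext_uminus[of "\<lambda>(m, S). \<Sum>c\<leftarrow>coords.
     csc (of_nat (m c)) (wedge_mono (m(c := m c - 1), {c}) (\<lambda>_. 0, S))", folded dform_def]

lemmas fgrade_linear =
   lin_ext_add[of "\<lambda>(m :: coord \<Rightarrow> nat, S :: coord set). Poly_Mapping.single (m, S) ((- 1) ^ card S)", folded fgrade_def]
   lin_ext_csc[of "\<lambda>(m :: coord \<Rightarrow> nat, S :: coord set). Poly_Mapping.single (m, S) ((- 1) ^ card S)", folded fgrade_def]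
   lin_ext_diff[of "\<lambda>(m :: coord \<Rightarrow> nat, S :: coord set). Poly_Mapping.single (m, S) ((- 1) ^ card S)", folded fgrade_def]
   lin_ext_sum[of "\<lambda>(m :: coord \<Rightarrow> nat, S :: coord set). Poly_Mapping.single (m, S) ((- 1) ^ card S)", folded fgrade_def]
   lin_ext_uminus[of "\<lambda>(m :: coord \<Rightarrow> nat, S :: coord set). Poly_Mapping.single (m, S) ((- 1) ^ card S)", folded fgrade_def]

text \<open>The Leibniz rule for one coordinate c at a time. The scalar t leaves room for the twist,
  which is the same in all three terms by \<open>bideg_dterm\<close>.\<close>

lemma dterm_leibniz:
  "csc t (if S \<inter> T = {} then csc ((- 1) ^ ninv S T) (dterm (\<lambda>c. m c + n c) (S \<union> T) c) else 0)
   = csc t (bilin_ext wedge_mono (dterm m S c) (Poly_Mapping.single (n, T) 1))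
   + csc (t * (- 1) ^ card S) (bilin_ext wedge_mono (Poly_Mapping.single (m, S) 1) (dterm n T c))"
proof (cases "c \<notin> S \<and> c \<notin> T \<and> S \<inter> T = {}")
  case True
  \<comment> \<open>Moving dz_c past all of dz_S costs (-1)^(card S), the sign in the second summand
    of the rule.\<close>
  then have 1: "card S = ninv S {c} + ninv {c} S"
    using ninv_swap[of S "{c}"] by simp
  have sq: "(- 1 :: complex) ^ k * ((- 1) ^ k * z) = z" for k z
    by (cases "even k") simp_all
  \<comment> \<open>The exponents disagree if \<open>m c = 0\<close>, because subtraction truncates;
    the coefficient is then 0 on both sides.\<close>
  have shift: "Poly_Mapping.single (\<lambda>b. (m(c := m c - 1)) b + n b, A) (of_nat (m c) * z)
      = Poly_Mapping.single ((\<lambda>c. m c + n c)(c := m c + n c - 1), A) (of_nat (m c) * z)" for A and z :: complex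
  proof (cases "m c = 0")
    case False
    then have "(\<lambda>b. (m(c := m c - 1)) b + n b) = (\<lambda>c. m c + n c)(c := m c + n c - 1)"
      by (auto simp: fun_eq_iff)
    then show ?thesis by (simp only:)
  qed simp
  have shift': "Poly_Mapping.single (\<lambda>b. m b + (n(c := n c - 1)) b, A) (of_nat (n c) * z)
      = Poly_Mapping.single ((\<lambda>c. m c + n c)(c := m c + n c - 1), A) (of_nat (n c) * z)" for A and z :: complex
  proof (cases "n c = 0")
    case False
    then have "(\<lambda>b. m b + (n(c := n c - 1)) b) = (\<lambda>c. m c + n c)(c := m c + n c - 1)"
      by (auto simp: fun_eq_iff)
    then show ?thesis by (simp only:)
  qed simp
  let ?K = "Poly_Mapping.single ((\<lambda>c. m c + n c)(c := m c + n c - 1), insert c (S \<union> T))"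
  let ?e = "(- 1) ^ ninv {c} S * (- 1) ^ ninv {c} T * (- 1) ^ ninv S T :: complex"
  have "dterm m S c = csc (of_nat (m c)) (Poly_Mapping.single (m(c := m c - 1), insert c S) ((- 1) ^ ninv {c} S))"
    using True by (simp add: dterm_def)
  moreover have "wedge_mono (m(c := m c - 1), insert c S) (n, T)
      = Poly_Mapping.single (\<lambda>b. (m(c := m c - 1)) b + n b, insert c (S \<union> T)) ((- 1) ^ ninv {c} T * (- 1) ^ ninv S T)"
    using True by (simp add: wedge_mono_eq ninv_insert_left[of c S] power_add)
  ultimately have "bilin_ext wedge_mono (dterm m S c) (Poly_Mapping.single (n, T) 1) = csc (of_nat (m c)) (?K ?e)"
    by (simp only: bilin_ext_csc_left bilin_ext_single csc_simps(5) shift mult_1_right mult.assoc)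
  moreover have "dterm n T c = csc (of_nat (n c)) (Poly_Mapping.single (n(c := n c - 1), insert c T) ((- 1) ^ ninv {c} T))"
    using True by (simp add: dterm_def)
  moreover have "wedge_mono (m, S) (n(c := n c - 1), insert c T)
      = Poly_Mapping.single (\<lambda>b. m b + (n(c := n c - 1)) b, insert c (S \<union> T)) ((- 1) ^ ninv S {c} * (- 1) ^ ninv S T)"
    using True by (simp add: wedge_mono_eq ninv_insert_right[of c T] power_add)
  ultimately have "bilin_ext wedge_mono (dterm m S c) (Poly_Mapping.single (n, T) 1) = csc (of_nat (m c)) (?K ?e)"
    "bilin_ext wedge_mono (Poly_Mapping.single (m, S) 1) (dterm n T c)
     = csc (of_nat (n c)) (?K ((- 1) ^ ninv {c} T * ((- 1) ^ ninv S {c} * (- 1) ^ ninv S T)))"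
    by (simp_all only: bilin_ext_csc_right bilin_ext_single csc_simps(5) shift' mult_1 mult.assoc)
  moreover have "ninv {c} (S \<union> T) = ninv {c} S + ninv {c} T"
    using True ninv_Un_right[of S T] by simp
  then have "dterm (\<lambda>c. m c + n c) (S \<union> T) c
      = ?K ((of_nat (m c) + of_nat (n c)) * ((- 1) ^ ninv {c} S * (- 1) ^ ninv {c} T))"
    using True by (simp only: dterm_def Un_iff if_False of_nat_add power_add simp_thms)
  ultimately show ?thesis
    using True
    by (simp only: csc_simps(5) 1 power_add if_True flip: single_add)
      (simp only: algebra_simps sq csc_simps(5) simp_thms if_True)
next
  case False
  then show ?thesis
    by (auto simp: dterm_def wedge_mono_eq)
qed

lemma tprod_dterm_left:
  "tprod \<theta> (dterm m S c) (Poly_Mapping.single (n, T) 1) =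
   csc (twist \<theta> (bideg (m, S)) (bideg (n, T)))
     (bilin_ext wedge_mono (dterm m S c) (Poly_Mapping.single (n, T) 1))"
  using bideg_dterm[of c S m] by (cases "m c = 0") (auto simp: dterm_def tprod_single mult_ac)

lemma tprod_dterm_right:
  "tprod \<theta> (Poly_Mapping.single (n, T) 1) (dterm m S c) =
   csc (twist \<theta> (bideg (n, T)) (bideg (m, S)))
     (bilin_ext wedge_mono (Poly_Mapping.single (n, T) 1) (dterm m S c))"
  using bideg_dterm[of c S m] by (cases "m c = 0") (auto simp: dterm_def tprod_single mult_ac)

lemma single_eq_csc: "Poly_Mapping.single k a = csc a (Poly_Mapping.single k 1)"
  by simp

lemma dform_tprod_single:
  "dform (tprod \<theta> (Poly_Mapping.single k 1) (Poly_Mapping.single l 1)) =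
     tprod \<theta> (dform (Poly_Mapping.single k 1)) (Poly_Mapping.single l 1)
   + tprod \<theta> (fgrade (Poly_Mapping.single k 1)) (dform (Poly_Mapping.single l 1))"
proof -
  obtain m S n T where kl: "k = (m, S)" "l = (n, T)"
    by (metis surj_pair)
  let ?t = "twist \<theta> (bideg (m, S)) (bideg (n, T))"
  have "dform (tprod \<theta> (Poly_Mapping.single k 1) (Poly_Mapping.single l 1))
     = (\<Sum>c\<in>UNIV. csc ?t (if S \<inter> T = {} then csc ((- 1) ^ ninv S T) (dterm (\<lambda>c. m c + n c) (S \<union> T) c) else 0))"
    by (simp add: kl tprod_single wedge_mono_eq dform_single csc_sum)
  also have "\<dots> = (\<Sum>c\<in>UNIV. tprod \<theta> (dterm m S c) (Poly_Mapping.single (n, T) 1)) +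
      (\<Sum>c\<in>UNIV. csc ((- 1) ^ card S) (tprod \<theta> (Poly_Mapping.single (m, S) 1) (dterm n T c)))"
    by (simp add: dterm_leibniz sum.distrib tprod_dterm_left tprod_dterm_right mult.commute)
  also have "\<dots> = tprod \<theta> (dform (Poly_Mapping.single k 1)) (Poly_Mapping.single l 1)
   + tprod \<theta> (fgrade (Poly_Mapping.single k 1)) (dform (Poly_Mapping.single l 1))"
    unfolding kl fgrade_single mult_1 single_eq_csc[of _ "(- 1) ^ card S"]
    by (simp add: dform_single tprod_linear csc_sum del: csc_simps(5)) 
  finally show ?thesis .
qed

text \<open>The undeformed differential is a graded derivation of the deformed product because it
  preserves bidegrees, so the twist factors out of each monomial identity.\<close>

lemma dform_tprod:
  "dform (tprod \<theta> v w) = tprod \<theta> (dform v) w + tprod \<theta> (fgrade v) (dform w)"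
proof (induction v rule: poly_mapping_single_induct)
  case (add v k a)
  have "dform (tprod \<theta> (Poly_Mapping.single k 1) w) =
     tprod \<theta> (dform (Poly_Mapping.single k 1)) w + tprod \<theta> (fgrade (Poly_Mapping.single k 1)) (dform w)"
  proof (induction w rule: poly_mapping_single_induct)
    case (add w l b)
    then show ?case
      by (simp add: dform_linear tprod_linear single_eq_csc[of _ b] dform_tprod_single csc_add del: csc_simps(5))
  qed simp
  with add show ?case
    by (simp add: dform_linear tprod_linear fgrade_linear single_eq_csc[of _ a] csc_add del: csc_simps(5))
qed simp

lemma fgrade_tprod: "fgrade (tprod \<theta> v w) = tprod \<theta> (fgrade v) (fgrade w)"
proof (induction v rule: poly_mapping_single_induct)
  case (add v k a)
  have "fgrade (tprod \<theta> (Poly_Mapping.single k 1) w) = tprod \<theta> (fgrade (Poly_Mapping.single k 1)) (fgrade w)"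
  proof (induction w rule: poly_mapping_single_induct)
    case (add w l b)
    have "fgrade (tprod \<theta> (Poly_Mapping.single k 1) (Poly_Mapping.single l 1))
        = tprod \<theta> (fgrade (Poly_Mapping.single k 1)) (fgrade (Poly_Mapping.single l 1))"
      by (cases k; cases l)
        (auto simp: tprod_single wedge_mono_eq card_Un_disjoint power_add mult_ac)
    with add show ?case
      by (simp add: tprod_linear fgrade_linear single_eq_csc[of _ b] del: csc_simps(5))
  qed simp
  with add show ?case
    by (simp add: tprod_linear fgrade_linear single_eq_csc[of _ a] del: csc_simps(5))
qed simp

lemma fgrade_dterm: "fgrade (dterm m S c) = csc ((- 1) ^ Suc (card S)) (dterm m S c)"
  by (simp add: dterm_def mult_ac single_uminus)

lemma fgrade_dform: "fgrade (dform v) = - dform (fgrade v)"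
proof (induction v rule: poly_mapping_single_induct)
  case (add v k a)
  then show ?case
    by (cases k) (simp add: dform_linear fgrade_linear dform_single fgrade_dterm csc_sum sum_negf)
qed simp

lemma dform_dform [simp]: "dform (dform v) = 0"
proof (induction v rule: poly_mapping_single_induct)
  case (add v k a)
  obtain m S where k: "k = (m, S)" by (metis surj_pair)
  \<comment> \<open>The contribution of differentiating z_c first and z_b second, with the exponents
    written symmetrically so that exchanging b and c affects only the sign.\<close>
  define T :: "coord \<Rightarrow> coord \<Rightarrow> form" where "T c b = (if c \<in> S \<or> b \<in> insert c S then 0 else
    Poly_Mapping.single (\<lambda>x. m x - of_bool (x = c) - of_bool (x = b), insert b (insert c S))
     (of_nat (m c) * of_nat (m b) * (- 1) ^ (ninv {c} S + ninv {b} S + ninv {b} {c})))" for c b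
  have "dform (dterm m S c) = (\<Sum>b\<in>UNIV. T c b)" for c
  proof (cases "c \<in> S")
    case False
    have "csc ((- 1) ^ ninv {c} S * of_nat (m c)) (dterm (m(c := m c - 1)) (insert c S) b) = T c b" for b
    proof (cases "b \<in> insert c S")
      case False2: False
      have "(m(c := m c - 1))(b := m b - 1) = (\<lambda>x. m x - of_bool (x = c) - of_bool (x = b))"
        using False2 by (auto simp: fun_eq_iff)
      with False False2 show ?thesis
        by (simp add: T_def dterm_def ninv_insert_right[of c S] power_add mult_ac)
    qed (simp add: T_def dterm_def)
    with False show ?thesis
      by (subst dterm_def) (simp add: dform_single csc_sum mult.commute)
  qed (simp add: T_def dterm_def)
  then have d: "dform (\<Sum>c\<in>UNIV. dterm m S c) = (\<Sum>c\<in>UNIV. \<Sum>b\<in>UNIV. T c b)"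
    by (simp add: dform_linear)
  have anti: "T c b = - T b c" for c b
  proof (cases "c \<in> S \<or> b \<in> S \<or> b = c")
    case False
    have "(- 1) ^ ninv {c} {b} = - ((- 1 :: complex) ^ ninv {b} {c})"
    proof -
      have "ninv {b} {c} + ninv {c} {b} = 1"
        using False ninv_swap[of "{b}" "{c}"] by simp
      then show ?thesis
        by (cases "ninv {b} {c}") auto
    qed
    moreover have "(\<lambda>x. m x - of_bool (x = b) - of_bool (x = c)) = (\<lambda>x. m x - of_bool (x = c) - of_bool (x = b))"
      by (simp add: add.commute)
    ultimately show ?thesis
      using False by (auto simp: T_def power_add insert_commute mult_ac single_uminus)
  qed (auto simp: T_def)
  let ?Z = "\<Sum>c\<in>UNIV. \<Sum>b\<in>UNIV. T c b"
  have "?Z = (\<Sum>c\<in>UNIV. \<Sum>b\<in>UNIV. - T b c)"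
    by (intro sum.cong refl anti)
  also have "\<dots> = - ?Z"
    unfolding sum_negf by (subst sum.swap) simp
  finally have "?Z + ?Z = 0"
    by (metis neg_eq_iff_add_eq_0)
  then have "csc 2 ?Z = 0"
    by (simp add: csc_add_left[of 1 1, simplified])
  then have "csc (1 / 2) (csc 2 ?Z) = 0"
    by simp
  then have "?Z = 0"
    by (simp del: csc_simps(2))
  with add d show ?case
    by (simp add: dform_linear k dform_single)
qed simp

section \<open>The ideal of the sphere\<close>

lemma fgrade_var [simp]: "fgrade (var c) = var c" and fgrade_fone [simp]: "fgrade fone = fone"
  and dform_fone [simp]: "dform fone = 0"
  by (simp_all add: var_def fone_def dform_single dterm_def)

lemma fgrade_rsq [simp]: "fgrade rsq = rsq"
  by (simp add: rsq_def wedge_eq_tprod fgrade_linear fgrade_tprod)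

lemma rdr_props: "dform rsq = csc 2 rdr" "dform rdr = 0" "fgrade rdr = - rdr"
  by (simp_all add: rdr_def dform_linear fgrade_linear fgrade_dform)

text \<open>With d(r^2) = 2 r dr and d(r dr) = 0, the coefficients a, b of an element of the ideal
  become da and 2a - db; the minus sign comes from passing the one-form r dr.\<close>

lemma dform_sphere_ideal: "\<omega> \<in> sphere_ideal \<Longrightarrow> dform \<omega> \<in> sphere_ideal"
proof -
  assume "\<omega> \<in> sphere_ideal"
  then obtain a b where \<omega>: "\<omega> = wedge (rsq - fone) a + wedge rdr b"
    by (auto simp: sphere_ideal_def)
  have "dform \<omega> = wedge (rsq - fone) (dform a) + wedge rdr (csc 2 a - dform b)"
    using tprod_linear(2)[of 0 "-1" rdr "dform b"]
    by (simp add: \<omega> wedge_eq_tprod dform_tprod dform_linear fgrade_linear rdr_props tprod_linear algebra_simps)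
  then show ?thesis
    by (auto simp: sphere_ideal_def)
qed

lemma fgrade_sphere_ideal: "\<omega> \<in> sphere_ideal \<Longrightarrow> fgrade \<omega> \<in> sphere_ideal"
proof -
  assume "\<omega> \<in> sphere_ideal"
  then obtain a b where \<omega>: "\<omega> = wedge (rsq - fone) a + wedge rdr b"
    by (auto simp: sphere_ideal_def)
  have "fgrade \<omega> = wedge (rsq - fone) (fgrade a) + wedge rdr (- fgrade b)"
    using tprod_linear(2)[of 0 "-1" rdr "fgrade b"] tprod_linear(6)[of 0 rdr "-1" "fgrade b"]
    by (simp add: \<omega> wedge_eq_tprod fgrade_tprod fgrade_linear rdr_props)
  then show ?thesis
    by (auto simp: sphere_ideal_def)
qed

declare One_nat_def [simp del]

section \<open>Two-sided ideals\<close>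

lemma two_sided_ideal_add:
  assumes "x \<in> two_sided_ideal S" "y \<in> two_sided_ideal S"
  shows "x + y \<in> two_sided_ideal S"
  using assms by (induction x) (auto simp: add.assoc intro: two_sided_ideal.step)

lemma two_sided_ideal_mult:
  assumes "x \<in> two_sided_ideal S"
  shows "a * x * b \<in> two_sided_ideal S"
  using assms
proof (induction x)
  case (step r y c d)
  then show ?case
    using two_sided_ideal.step[OF step(1) step(3), of "a * c" "d * b"] by (simp add: algebra_simps)
qed (simp add: two_sided_ideal.zero)

lemma two_sided_ideal_generator: "r \<in> S \<Longrightarrow> r \<in> two_sided_ideal S"
  using two_sided_ideal.step[OF _ two_sided_ideal.zero, of r S 1 1] by simp

lemma two_sided_ideal_left: "x \<in> two_sided_ideal S \<Longrightarrow> a * x \<in> two_sided_ideal S"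
  using two_sided_ideal_mult[of x S a 1] by simp

lemma two_sided_ideal_right: "x \<in> two_sided_ideal S \<Longrightarrow> x * a \<in> two_sided_ideal S"
  using two_sided_ideal_mult[of x S 1 a] by simp

lemma two_sided_ideal_uminus: "x \<in> two_sided_ideal S \<Longrightarrow> - x \<in> two_sided_ideal S"
  using two_sided_ideal_left[of x S "-1"] by simp

lemma two_sided_ideal_csc:
  "x \<in> two_sided_ideal S \<Longrightarrow> csc c x \<in> two_sided_ideal S" for x :: "'g free_alg"
  using two_sided_ideal_left[of x S "csc c 1"] by (simp add: csc_mult_left)

lemma E_eq_refl [simp]: "E_eq \<theta> x x"
  by (simp add: E_eq_def two_sided_ideal.zero)

lemma E_eq_sym: "E_eq \<theta> x y \<Longrightarrow> E_eq \<theta> y x"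
  using two_sided_ideal_uminus[of "x - y"] by (simp add: E_eq_def)

lemma E_eq_trans [trans]: "E_eq \<theta> x y \<Longrightarrow> E_eq \<theta> y z \<Longrightarrow> E_eq \<theta> x z"
  using two_sided_ideal_add[of "x - y" _ "y - z"] by (simp add: E_eq_def)

lemma E_eq_add: "E_eq \<theta> x y \<Longrightarrow> E_eq \<theta> x' y' \<Longrightarrow> E_eq \<theta> (x + x') (y + y')"
  using two_sided_ideal_add[of "x - y" _ "x' - y'"] by (simp add: E_eq_def algebra_simps)

lemma E_eq_uminus: "E_eq \<theta> x y \<Longrightarrow> E_eq \<theta> (- x) (- y)"
  using two_sided_ideal_uminus[of "x - y"] by (simp add: E_eq_def)

lemma E_eq_diff: "E_eq \<theta> x y \<Longrightarrow> E_eq \<theta> x' y' \<Longrightarrow> E_eq \<theta> (x - x') (y - y')"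
  using E_eq_add[OF _ E_eq_uminus, of \<theta> x y x' y'] by simp

lemma E_eq_mult: "E_eq \<theta> x y \<Longrightarrow> E_eq \<theta> x' y' \<Longrightarrow> E_eq \<theta> (x * x') (y * y')"
  using two_sided_ideal_add[OF two_sided_ideal_right[of "x - y" _ x'] two_sided_ideal_left[of "x' - y'" _ y]]
  by (simp add: E_eq_def algebra_simps)

lemma E_eq_csc: "E_eq \<theta> x y \<Longrightarrow> E_eq \<theta> (csc c x) (csc c y)"
  using two_sided_ideal_csc[of "x - y"] by (simp add: E_eq_def csc_diff)

lemma E_eq_sum: "(\<And>i. i \<in> A \<Longrightarrow> E_eq \<theta> (f i) (g i)) \<Longrightarrow> E_eq \<theta> (sum f A) (sum g A)"
  by (induction A rule: infinite_finite_induct) (simp_all add: E_eq_add)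

lemma E_eq_generator: "x - y \<in> E_rel \<theta> \<Longrightarrow> E_eq \<theta> x y"
  by (simp add: E_eq_def two_sided_ideal_generator)

lemma ten_add_left: "E_eq \<theta> (ten (csc c a + b) \<omega>) (csc c (ten a \<omega>) + ten b \<omega>)"
  by (rule E_eq_generator, unfold diff_diff_eq [symmetric] E_rel_def) blast

lemma ten_add_right: "E_eq \<theta> (ten a (csc c \<omega> + \<tau>)) (csc c (ten a \<omega>) + ten a \<tau>)"
  by (rule E_eq_generator, unfold diff_diff_eq [symmetric] E_rel_def) blast

lemma ten_ideal_left: "a \<in> SL_ideal \<theta> \<Longrightarrow> E_eq \<theta> (ten a \<omega>) 0"
  by (rule E_eq_generator, unfold diff_zero E_rel_def) blast

lemma ten_ideal_right: "\<omega> \<in> sphere_ideal \<Longrightarrow> E_eq \<theta> (ten a \<omega>) 0"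
  by (rule E_eq_generator, unfold diff_zero E_rel_def) blast

lemma ten_mult: "E_eq \<theta> (ten a \<omega> * ten b \<tau>) (ten (a * b) (tprod \<theta> \<omega> \<tau>))"
  by (rule E_eq_generator, unfold diff_zero E_rel_def) blast

lemma ten_one: "E_eq \<theta> (ten 1 fone) 1"
  by (rule E_eq_generator) (simp add: E_rel_def)

lemma rhoinv_rho2: "E_eq \<theta> (rhoinv * rho2 \<theta>) 1" and rho2_rhoinv: "E_eq \<theta> (rho2 \<theta> * rhoinv) 1"
  by (rule E_eq_generator; simp add: E_rel_def)+

lemma ten_zero: "E_eq \<theta> (ten a 0) 0"
proof -
  have "0 = wedge (rsq - fone) 0 + wedge rdr 0"
    by (simp add: wedge_eq_tprod)
  then have "0 \<in> sphere_ideal"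
    unfolding sphere_ideal_def by blast
  then show ?thesis
    by (rule ten_ideal_right)
qed

lemma ten_csc_right: "E_eq \<theta> (ten a (csc c \<omega>)) (csc c (ten a \<omega>))"
  using E_eq_trans[OF ten_add_right[of \<theta> a c \<omega> 0] E_eq_add[OF E_eq_refl ten_zero]] by simp

lemma ten_uminus_right: "E_eq \<theta> (ten a (- \<omega>)) (- ten a \<omega>)"
  using ten_csc_right[of \<theta> a "-1" \<omega>] by simp

section \<open>Grading and differential on the enlarged algebra\<close>

text \<open>The multiplicative extension of the parity sign, with the inverse of \<rho>^2 counted as
  even. It supplies the sign in the Leibniz rule for \<open>dE\<close>.\<close>

definition gr_letters :: "egen list \<Rightarrow> eelem" where
  "gr_letters gs = (\<Prod>g\<leftarrow>gs. grade_gen g)"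

definition grE :: "eelem \<Rightarrow> eelem" where
  "grE = lin_ext (\<lambda>w. gr_letters (letters w))"

lemma lin_ext_word_mult:
  fixes h g f :: "'g word \<Rightarrow> 'k free_alg"
  assumes "\<And>u v. h (u + v) = f u * g v"
  shows "lin_ext h (x * y) = lin_ext f x * lin_ext g y"
proof (induction x rule: poly_mapping_single_induct)
  case (add x k a)
  have "lin_ext h (Poly_Mapping.single k a * y) = csc a (f k) * lin_ext g y"
  proof (induction y rule: poly_mapping_single_induct)
    case (add y l b)
    then show ?case
      by (simp add: distrib_left lin_ext_add mult_single assms csc_mult_left csc_mult_right csc_add mult.commute[of b])
  qed simp
  with add show ?case
    by (simp add: distrib_right lin_ext_add)
qed simp

lemma letters_plus [simp]: "letters (u + v) = letters u @ letters v"
  by (simp add: plus_word_def)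

lemma grE_mult: "grE (x * y) = grE x * grE y"
  unfolding grE_def by (rule lin_ext_word_mult) (simp add: gr_letters_def)

lemma single_gen: "Poly_Mapping.single (Word (g # gs)) 1 = gen g * Poly_Mapping.single (Word gs) (1::complex)"
  by (simp add: gen_def mult_single plus_word_def)

lemma d_letters_append:
  "d_letters \<theta> (us @ vs) = d_letters \<theta> us * Poly_Mapping.single (Word vs) 1 + gr_letters us * d_letters \<theta> vs"
proof (induction us)
  case (Cons u us)
  have "Poly_Mapping.single (Word (us @ vs)) (1::complex) = Poly_Mapping.single (Word us) 1 * Poly_Mapping.single (Word vs) 1"
    by (simp add: mult_single plus_word_def)
  with Cons show ?case
    by (simp add: gr_letters_def algebra_simps)
qed (simp add: gr_letters_def)

lemma lin_ext_word_id: "lin_ext (\<lambda>w. Poly_Mapping.single w 1) x = x"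
  by (induction x rule: poly_mapping_single_induct) (simp_all add: lin_ext_add)

lemma dE_mult: "dE \<theta> (x * y) = dE \<theta> x * y + grE x * dE \<theta> y"
proof -
  \<comment> \<open>The identity map is also written as a linear extension, so that the Leibniz rule
    on words extends bilinearly in one uniform induction.\<close>
  define I :: "egen word \<Rightarrow> eelem" where "I w = Poly_Mapping.single w 1" for w
  define D where "D w = d_letters \<theta> (letters w)" for w
  define G where "G w = gr_letters (letters w)" for w
  have D_plus: "D (u + v) = D u * I v + G u * D v" for u v
    by (simp add: D_def I_def G_def d_letters_append)
  have "lin_ext D (x * y) = lin_ext D x * lin_ext I y + lin_ext G x * lin_ext D y"
  proof (induction x rule: poly_mapping_single_induct)
    case (add x k a)
    have "lin_ext D (Poly_Mapping.single k a * y) = csc a (D k * lin_ext I y + G k * lin_ext D y)"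
    proof (induction y rule: poly_mapping_single_induct)
      case (add y l b)
      then show ?case
        by (simp add: distrib_left lin_ext_add mult_single D_plus csc_mult_right csc_add mult.commute[of b] add_ac)
    qed simp
    with add show ?case
      by (simp add: distrib_right lin_ext_add csc_add csc_mult_left add_ac)
  qed simp
  then show ?thesis
    by (simp add: dE_def grE_def lin_ext_word_id I_def [abs_def] D_def [abs_def] G_def [abs_def])
qed

lemma dE_zero [simp]: "dE \<theta> 0 = 0" and grE_zero [simp]: "grE 0 = 0"
  by (simp_all add: dE_def grE_def)

lemma dE_linear:
  "dE \<theta> (x + y) = dE \<theta> x + dE \<theta> y" "dE \<theta> (x - y) = dE \<theta> x - dE \<theta> y"
  "dE \<theta> (csc c x) = csc c (dE \<theta> x)" "dE \<theta> (- x) = - dE \<theta> x" "dE \<theta> (sum f A) = (\<Sum>i\<in>A. dE \<theta> (f i))"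
  by (simp_all add: dE_def lin_ext_add lin_ext_diff lin_ext_csc lin_ext_uminus lin_ext_sum)

lemma grE_linear:
  "grE (x + y) = grE x + grE y" "grE (x - y) = grE x - grE y"
  "grE (csc c x) = csc c (grE x)" "grE (- x) = - grE x" "grE (sum f A) = (\<Sum>i\<in>A. grE (f i))"
  by (simp_all add: grE_def lin_ext_add lin_ext_diff lin_ext_csc lin_ext_uminus lin_ext_sum)

lemma single_Nil [simp]: "Poly_Mapping.single (Word []) 1 = (1 :: 'g free_alg)"
  by (metis single_one zero_word_def)

lemma dE_gens [simp]:
  "dE \<theta> 1 = 0" "dE \<theta> (ten a \<omega>) = ten a (dform \<omega>)" "dE \<theta> rhoinv = - (rhoinv * drho2 \<theta> * rhoinv)"
  by (simp_all add: dE_def ten_def rhoinv_def gen_def del: single_Nil flip: single_Nil)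
    (simp_all add: ten_def gen_def)

lemma grE_gens [simp]:
  "grE 1 = 1" "grE (ten a \<omega>) = ten a (fgrade \<omega>)" "grE rhoinv = rhoinv"
  by (simp_all add: grE_def gr_letters_def ten_def rhoinv_def gen_def del: single_Nil flip: single_Nil)
    (simp_all add: ten_def rhoinv_def gen_def)

section \<open>Descent of the grading and the differential to the quotient\<close>

lemma index_cases:
  assumes "k \<in> {1..4::nat}"
  obtains "k = 1" | "k = 2" | "k = 3" | "k = 4"
proof -
  have "k = 1 \<or> k = 2 \<or> k = 3 \<or> k = 4"
    using assms unfolding atLeastAtMost_iff by linarith
  with that show thesis by blast
qed

lemma pmat_eqs:
  "pmat \<theta> 1 1 = csc (1 / 2) (fone + var X)" "pmat \<theta> 1 2 = 0"
  "pmat \<theta> 1 3 = csc (1 / 2) (var Al)" "pmat \<theta> 1 4 = csc (1 / 2) (var Be)"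
  "pmat \<theta> 2 1 = 0" "pmat \<theta> 2 2 = csc (1 / 2) (fone + var X)"
  "pmat \<theta> 2 3 = csc (- mu \<theta> / 2) (var Bes)" "pmat \<theta> 2 4 = csc (cnj (mu \<theta>) / 2) (var Als)"
  "pmat \<theta> 3 1 = csc (1 / 2) (var Als)" "pmat \<theta> 3 2 = csc (- cnj (mu \<theta>) / 2) (var Be)"
  "pmat \<theta> 3 3 = csc (1 / 2) (fone - var X)" "pmat \<theta> 3 4 = 0"
  "pmat \<theta> 4 1 = csc (1 / 2) (var Bes)" "pmat \<theta> 4 2 = csc (mu \<theta> / 2) (var Al)"
  "pmat \<theta> 4 3 = 0" "pmat \<theta> 4 4 = csc (1 / 2) (fone - var X)"
  by (simp_all add: pmat_def)

lemma fgrade_pmat: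
  assumes "k \<in> {1..4}" "l \<in> {1..4}"
  shows "fgrade (pmat \<theta> k l) = pmat \<theta> k l"
  by (rule index_cases[OF assms(1)]; rule index_cases[OF assms(2)]) (simp_all add: pmat_eqs fgrade_linear)

lemma grE_rho2 [simp]: "grE (rho2 \<theta>) = rho2 \<theta>"
  unfolding rho2_def rho2_with_def grE_linear grE_gens
  by (intro arg_cong[where f="csc _"] sum.cong refl) (simp add: fgrade_pmat)

lemma dE_rho2 [simp]: "dE \<theta> (rho2 \<theta>) = drho2 \<theta>"
  by (simp add: rho2_def drho2_def rho2_with_def dE_linear)

text \<open>This holds only modulo the relations: \<open>ten a (- \<omega>)\<close> and
  \<open>- ten a \<omega>\<close> are different elements of the free algebra.\<close>

lemma grE_drho2: "E_eq \<theta> (grE (drho2 \<theta>)) (- drho2 \<theta>)"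
proof -
  have "E_eq \<theta> (grE (drho2 \<theta>)) (csc (1 / 2) (\<Sum>i=1..4. \<Sum>k=1..4. \<Sum>l=1..4.
     csc (eta \<theta> l k) (- ten (sl_adj (Amat i l) * Amat i k) (dform (pmat \<theta> k l)))))"
    unfolding drho2_def rho2_with_def grE_linear grE_gens fgrade_dform
    by (intro E_eq_csc E_eq_sum) (simp only: fgrade_pmat ten_uminus_right)
  also have "\<dots> = - drho2 \<theta>"
    unfolding drho2_def rho2_with_def by (simp only: csc_simps sum_negf)
  finally show ?thesis .
qed

lemma dE_drho2: "E_eq \<theta> (dE \<theta> (drho2 \<theta>)) 0"
proof -
  have "E_eq \<theta> (dE \<theta> (drho2 \<theta>)) (csc (1 / 2) (\<Sum>i=1..(4::nat). \<Sum>k=1..4. \<Sum>l=1..4. csc (eta \<theta> l k) 0))"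
    unfolding drho2_def rho2_with_def dE_linear dE_gens dform_dform
    by (intro E_eq_csc E_eq_sum ten_zero)
  then show ?thesis by simp
qed

lemma E_rel_cases:
  assumes "r \<in> E_rel \<theta>"
  obtains c a b \<omega> where "r = ten (csc c a + b) \<omega> - csc c (ten a \<omega>) - ten b \<omega>"
  | c a \<omega> \<tau> where "r = ten a (csc c \<omega> + \<tau>) - csc c (ten a \<omega>) - ten a \<tau>"
  | a \<omega> where "r = ten a \<omega>" "a \<in> SL_ideal \<theta>"
  | a \<omega> where "r = ten a \<omega>" "\<omega> \<in> sphere_ideal"
  | a b \<omega> \<tau> where "r = ten a \<omega> * ten b \<tau> - ten (a * b) (tprod \<theta> \<omega> \<tau>)"
  | "r = ten 1 fone - 1" | "r = rhoinv * rho2 \<theta> - 1" | "r = rho2 \<theta> * rhoinv - 1"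
  using assms unfolding E_rel_def by blast

lemma grE_rel:
  assumes "r \<in> E_rel \<theta>"
  shows "E_eq \<theta> (grE r) 0"
proof -
  have *: "E_eq \<theta> (x - y - z) 0" if "E_eq \<theta> x (y + z)" for x y z
    using that by (simp add: E_eq_def algebra_simps)
  have **: "E_eq \<theta> (x - y) 0" if "E_eq \<theta> x y" for x y
    using that by (simp add: E_eq_def)
  from assms show ?thesis
    by (cases rule: E_rel_cases)
      (simp_all add: grE_linear grE_mult fgrade_linear fgrade_tprod fgrade_sphere_ideal
        * ** ten_add_left ten_add_right ten_ideal_left ten_ideal_right ten_mult ten_one
        rhoinv_rho2 rho2_rhoinv)
qed

text \<open>Product relations are preserved by \<open>dform_tprod\<close>, those of the sphere by
  \<open>dform_sphere_ideal\<close>. For the two inverse relations, the prescribed differential of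
  \<open>rhoinv\<close> is exactly the one obtained by differentiating the product with
  \<open>rho2\<close>.\<close>

lemma dE_rel:
  assumes "r \<in> E_rel \<theta>"
  shows "E_eq \<theta> (dE \<theta> r) 0"
proof -
  have *: "E_eq \<theta> (x - y - z) 0" if "E_eq \<theta> x (y + z)" for x y z
    using that by (simp add: E_eq_def algebra_simps)
  have **: "E_eq \<theta> (x - y) 0" if "E_eq \<theta> x y" for x y
    using that by (simp add: E_eq_def)
  have "E_eq \<theta> (dE \<theta> (ten a \<omega> * ten b \<tau> - ten (a * b) (tprod \<theta> \<omega> \<tau>))) 0" for a b \<omega> \<tau>
  proof -
    have "E_eq \<theta> (ten a (dform \<omega>) * ten b \<tau> + ten a (fgrade \<omega>) * ten b (dform \<tau>))
        (ten (a * b) (tprod \<theta> (dform \<omega>) \<tau>) + ten (a * b) (tprod \<theta> (fgrade \<omega>) (dform \<tau>)))"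
      by (intro E_eq_add ten_mult)
    also have "E_eq \<theta> \<dots> (ten (a * b) (dform (tprod \<theta> \<omega> \<tau>)))"
      unfolding dform_tprod
      using E_eq_sym[OF ten_add_right[of \<theta> "a * b" 1 "tprod \<theta> (dform \<omega>) \<tau>" "tprod \<theta> (fgrade \<omega>) (dform \<tau>)"]]
      by simp
    finally show ?thesis
      by (simp add: dE_linear dE_mult **)
  qed
  moreover have "E_eq \<theta> (dE \<theta> (ten 1 fone - 1)) 0"
    by (simp add: dE_linear ten_zero)
  moreover have "E_eq \<theta> (dE \<theta> (rhoinv * rho2 \<theta> - 1)) 0"
  proof -
    have "E_eq \<theta> (rhoinv * drho2 \<theta> * 1 - rhoinv * drho2 \<theta> * (rhoinv * rho2 \<theta>)) 0"
      using rhoinv_rho2[of \<theta>, THEN E_eq_sym] by (intro ** E_eq_mult E_eq_refl)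
    then show ?thesis
      by (simp add: dE_linear dE_mult mult.assoc)
  qed
  moreover have "E_eq \<theta> (dE \<theta> (rho2 \<theta> * rhoinv - 1)) 0"
  proof -
    have "E_eq \<theta> (1 * (drho2 \<theta> * rhoinv) - rho2 \<theta> * rhoinv * (drho2 \<theta> * rhoinv)) 0"
      using rho2_rhoinv[of \<theta>, THEN E_eq_sym] by (intro ** E_eq_mult E_eq_refl)
    then show ?thesis
      by (simp add: dE_linear dE_mult mult.assoc)
  qed
  moreover have "E_eq \<theta> (dE \<theta> (ten (csc c a + b) \<omega> - csc c (ten a \<omega>) - ten b \<omega>)) 0"
    "E_eq \<theta> (dE \<theta> (ten a (csc c \<omega> + \<tau>) - csc c (ten a \<omega>) - ten a \<tau>)) 0" for a b c \<omega> \<tau>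
    by (simp_all add: dE_linear dform_linear * ten_add_left ten_add_right)
  moreover have "E_eq \<theta> (dE \<theta> (ten a \<omega>)) 0" if "a \<in> SL_ideal \<theta> \<or> \<omega> \<in> sphere_ideal" for a \<omega>
    using that by (auto simp: dform_sphere_ideal ten_ideal_left ten_ideal_right)
  ultimately show ?thesis
    using assms by (elim E_rel_cases) (simp_all only: simp_thms)
qed

lemma grE_cong:
  assumes "E_eq \<theta> x y"
  shows "E_eq \<theta> (grE x) (grE y)"
proof -
  have "E_eq \<theta> (grE z) 0" if "z \<in> two_sided_ideal (E_rel \<theta>)" for z
    using that
  proof (induction z)
    case (step r y a b)
    have "E_eq \<theta> (grE a * grE r * grE b + grE y) (grE a * 0 * grE b + 0)"
      by (intro E_eq_add E_eq_mult E_eq_refl step grE_rel)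
    then show ?case by (simp add: grE_linear grE_mult)
  qed simp
  from this[of "x - y"] assms show ?thesis
    by (simp add: E_eq_def grE_linear)
qed

lemma dE_cong:
  assumes "E_eq \<theta> x y"
  shows "E_eq \<theta> (dE \<theta> x) (dE \<theta> y)"
proof -
  have "E_eq \<theta> (dE \<theta> z) 0" if "z \<in> two_sided_ideal (E_rel \<theta>)" for z
    using that
  proof (induction z)
    case (step r y a b)
    have "E_eq \<theta> r 0"
      using step by (simp add: E_eq_generator)
    \<comment> \<open>Each of the three Leibniz terms of a * r * b contains r,
      \<open>dE \<theta> r\<close> or \<open>grE r\<close>, and all of these vanish in the
      quotient.\<close>
    then have "E_eq \<theta> ((dE \<theta> a * r + grE a * dE \<theta> r) * b + grE a * grE r * dE \<theta> b + dE \<theta> y)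
        ((dE \<theta> a * 0 + grE a * 0) * b + grE a * 0 * dE \<theta> b + 0)"
      by (intro E_eq_add E_eq_mult E_eq_refl step grE_rel dE_rel)
    then show ?case by (simp add: dE_linear dE_mult grE_mult)
  qed simp
  from this[of "x - y"] assms show ?thesis
    by (simp add: E_eq_def dE_linear)
qed

lemma free_alg_induct [case_names add csc one gen]:
  assumes "\<And>x y. P x \<Longrightarrow> P y \<Longrightarrow> P (x + y)" "\<And>c x. P x \<Longrightarrow> P (csc c x)" "P 1"
    "\<And>g x. P x \<Longrightarrow> P (gen g * x)"
  shows "P (x :: 'g free_alg)"
proof (induction x rule: poly_mapping_single_induct)
  case zero
  show ?case using assms(2)[OF assms(3), of 0] by simp
next
  case (add x w c)
  have "P (Poly_Mapping.single (Word gs) 1)" for gs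
    by (induction gs) (use assms(3,4) in \<open>simp_all add: single_gen flip: zero_word_def\<close>)
  then have "P (csc c (Poly_Mapping.single (Word (letters w)) 1))"
    by (rule assms(2))
  with add assms(1) show ?case by simp
qed

lemma grE_dE: "E_eq \<theta> (grE (dE \<theta> x)) (- dE \<theta> (grE x))"
proof (induction x rule: free_alg_induct)
  case (add x y)
  then show ?case using E_eq_add[OF add] by (simp add: grE_linear dE_linear)
next
  case (csc c x)
  then show ?case using E_eq_csc[OF csc] by (simp add: grE_linear dE_linear)
next
  case (gen g x)
  have "E_eq \<theta> (grE (dE \<theta> (gen g))) (- dE \<theta> (grE (gen g)))"
  proof (cases g)
    case (Pure a \<omega>)
    then show ?thesis
      using ten_uminus_right by (simp add: fgrade_dform flip: ten_def)
  next
    case RhoInv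
    have "E_eq \<theta> (rhoinv * grE (drho2 \<theta>) * rhoinv) (rhoinv * (- drho2 \<theta>) * rhoinv)"
      by (intro E_eq_mult E_eq_refl grE_drho2)
    from E_eq_uminus[OF this] RhoInv show ?thesis
      by (simp add: grE_linear grE_mult flip: rhoinv_def)
  qed
  then have "E_eq \<theta> (grE (dE \<theta> (gen g)) * grE x + grE (grE (gen g)) * grE (dE \<theta> x))
     (- dE \<theta> (grE (gen g)) * grE x + grE (grE (gen g)) * (- dE \<theta> (grE x)))"
    by (intro E_eq_add E_eq_mult E_eq_refl gen)
  then show ?case
    by (simp add: dE_mult grE_mult dE_linear grE_linear)
qed simp

text \<open>On a product the two mixed terms cancel because the differential is odd
  (\<open>grE_dE\<close>), so only generators matter. For \<open>rhoinv\<close> the two terms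
  quadratic in \<open>drho2\<close> cancel for the same reason of parity.\<close>

lemma dE_dE: "E_eq \<theta> (dE \<theta> (dE \<theta> x)) 0"
proof (induction x rule: free_alg_induct)
  case (add x y)
  then show ?case using E_eq_add[OF add] by (simp add: dE_linear)
next
  case (csc c x)
  then show ?case using E_eq_csc[OF csc] by (simp add: dE_linear)
next
  case (gen g x)
  have "E_eq \<theta> (dE \<theta> (dE \<theta> (gen g))) 0"
  proof (cases g)
    case (Pure a \<omega>)
    then show ?thesis
      by (simp add: ten_zero flip: ten_def)
  next
    case RhoInv
    let ?r = "rhoinv" and ?d = "drho2 \<theta>"
    have "E_eq \<theta> (?r * ?d * ?r * ?d * ?r - ?r * (dE \<theta> ?d * ?r + grE ?d * (- (?r * ?d * ?r))))
       (?r * ?d * ?r * ?d * ?r - ?r * (0 * ?r + (- ?d) * (- (?r * ?d * ?r))))"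
      by (intro E_eq_add E_eq_diff E_eq_mult E_eq_refl dE_drho2 grE_drho2)
    with RhoInv show ?thesis
      by (simp add: dE_linear dE_mult algebra_simps flip: rhoinv_def)
  qed
  then have "E_eq \<theta> (dE \<theta> (dE \<theta> (gen g)) * x + grE (dE \<theta> (gen g)) * dE \<theta> x
      + (dE \<theta> (grE (gen g)) * dE \<theta> x + grE (grE (gen g)) * dE \<theta> (dE \<theta> x)))
     (0 * x + - dE \<theta> (grE (gen g)) * dE \<theta> x + (dE \<theta> (grE (gen g)) * dE \<theta> x + grE (grE (gen g)) * 0))"
    by (intro E_eq_add E_eq_mult E_eq_refl gen grE_dE)
  then show ?case
    by (simp add: dE_mult dE_linear)
qed simp

section \<open>Families of elements over all \<open>\<theta>\<close>\<close>

text \<open>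
  The quotient of \<open>eelem\<close> depends on \<open>\<theta>\<close> and is therefore not a type; the product of these quotients
  over all \<open>\<theta>\<close> is one. It has no instance of \<open>ring_1\<close>, since that would require \<open>0 \<noteq> 1\<close>.
\<close>

lifting_forget poly_mapping.lifting

quotient_type fam = "real \<Rightarrow> eelem" / "\<lambda>f g. \<forall>\<theta>. E_eq \<theta> (f \<theta>) (g \<theta>)"
  by (intro equivpI reflpI sympI transpI) (blast intro: E_eq_refl E_eq_sym E_eq_trans)+

instantiation fam :: "{ring, monoid_mult}"
begin

lift_definition zero_fam :: fam is "\<lambda>_. 0" .
lift_definition one_fam :: fam is "\<lambda>_. 1" .
lift_definition plus_fam :: "fam \<Rightarrow> fam \<Rightarrow> fam" is "\<lambda>f g \<theta>. f \<theta> + g \<theta>"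
  by (simp add: E_eq_add)
lift_definition minus_fam :: "fam \<Rightarrow> fam \<Rightarrow> fam" is "\<lambda>f g \<theta>. f \<theta> - g \<theta>"
  by (simp add: E_eq_diff)
lift_definition uminus_fam :: "fam \<Rightarrow> fam" is "\<lambda>f \<theta>. - f \<theta>"
  by (simp add: E_eq_uminus)
lift_definition times_fam :: "fam \<Rightarrow> fam \<Rightarrow> fam" is "\<lambda>f g \<theta>. f \<theta> * g \<theta>"
  by (simp add: E_eq_mult)

instance
  by standard (transfer; simp add: algebra_simps)+

end

text \<open>Scalars are functions of \<theta> because the phases vary with the parameter of the
  family.\<close>

lift_definition sc :: "(real \<Rightarrow> complex) \<Rightarrow> fam" is "\<lambda>c \<theta>. csc (c \<theta>) 1" .
lift_definition tn :: "(real \<Rightarrow> sl_free) \<Rightarrow> (real \<Rightarrow> form) \<Rightarrow> fam" is "\<lambda>a \<omega> \<theta>. ten (a \<theta>) (\<omega> \<theta>)" .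
lift_definition rinv :: fam is "\<lambda>_. rhoinv" .
lift_definition rho :: fam is rho2 .
lift_definition dq :: "fam \<Rightarrow> fam" is "\<lambda>f \<theta>. dE \<theta> (f \<theta>)"
  by (simp add: dE_cong)
lift_definition gq :: "fam \<Rightarrow> fam" is "\<lambda>f \<theta>. grE (f \<theta>)"
  by (simp add: grE_cong)

lemma sc_mult [simp]: "sc c * sc d = sc (\<lambda>\<theta>. c \<theta> * d \<theta>)"
  by transfer (simp add: csc_mult_left)

lemma sc_mult_left [simp]: "sc c * (sc d * x) = sc (\<lambda>\<theta>. c \<theta> * d \<theta>) * x"
  by (simp flip: mult.assoc)

lemma sc_one [simp]: "sc (\<lambda>_. 1) = 1" and sc_zero [simp]: "sc (\<lambda>_. 0) = 0"
  by (transfer, simp)+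

lemma sc_add: "sc (\<lambda>\<theta>. c \<theta> + d \<theta>) = sc c + sc d"
  by transfer (simp add: csc_add_left)

lemma sc_uminus: "sc (\<lambda>\<theta>. - c \<theta>) = - sc c"
  by transfer simp

lemma sc_commute: "x * sc c = sc c * x"
  by transfer (simp add: csc_mult_left csc_mult_right)

lemma sc_left_commute: "x * (sc c * y) = sc c * (x * y)"
  by (metis mult.assoc sc_commute)

lemma half_cancel: "x + x = 0 \<Longrightarrow> x = (0 :: fam)"
proof -
  assume *: "x + x = 0"
  have "x = sc (\<lambda>_. 1 / 2 + 1 / 2) * x"
    by simp
  also have "\<dots> = sc (\<lambda>_. 1 / 2) * (x + x)"
    by (simp only: sc_add distrib_left distrib_right)
  finally show ?thesis
    using * by simp
qed

lemma tn_mult: "tn a \<omega> * tn b \<tau> = tn (\<lambda>\<theta>. a \<theta> * b \<theta>) (\<lambda>\<theta>. tprod \<theta> (\<omega> \<theta>) (\<tau> \<theta>))"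
  by transfer (simp add: ten_mult)

lemma tn_one: "tn (\<lambda>_. 1) (\<lambda>_. fone) = 1"
  by transfer (simp add: ten_one)

lemma tn_zero_right [simp]: "tn a (\<lambda>_. 0) = 0"
  by transfer (simp add: ten_zero)

lemma tn_ideal_left: "(\<And>\<theta>. a \<theta> \<in> SL_ideal \<theta>) \<Longrightarrow> tn a \<omega> = 0"
  by transfer (simp add: ten_ideal_left)

lemma tn_ideal_right: "(\<And>\<theta>. \<omega> \<theta> \<in> sphere_ideal) \<Longrightarrow> tn a \<omega> = 0"
  by transfer (simp add: ten_ideal_right)

lemma tn_zero_left [simp]: "tn (\<lambda>_. 0) \<omega> = 0"
  by (rule tn_ideal_left) (simp add: SL_ideal_def two_sided_ideal.zero)

lemma tn_lin_left: "tn (\<lambda>\<theta>. csc (c \<theta>) (a \<theta>) + b \<theta>) \<omega> = sc c * tn a \<omega> + tn b \<omega>"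
  by transfer (simp add: csc_mult_left ten_add_left)

lemma tn_lin_right: "tn a (\<lambda>\<theta>. csc (c \<theta>) (\<omega> \<theta>) + \<tau> \<theta>) = sc c * tn a \<omega> + tn a \<tau>"
  by transfer (simp add: csc_mult_left ten_add_right)

lemma tn_add_left: "tn (\<lambda>\<theta>. a \<theta> + b \<theta>) \<omega> = tn a \<omega> + tn b \<omega>"
  using tn_lin_left[of "\<lambda>_. 1"] by simp

lemma tn_add_right: "tn a (\<lambda>\<theta>. \<omega> \<theta> + \<tau> \<theta>) = tn a \<omega> + tn a \<tau>"
  using tn_lin_right[of a "\<lambda>_. 1"] by simp

lemma tn_csc_left: "tn (\<lambda>\<theta>. csc (c \<theta>) (a \<theta>)) \<omega> = sc c * tn a \<omega>"
  using tn_lin_left[of c a "\<lambda>_. 0"] by simp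

lemma tn_csc_right: "tn a (\<lambda>\<theta>. csc (c \<theta>) (\<omega> \<theta>)) = sc c * tn a \<omega>"
  using tn_lin_right[of a c \<omega> "\<lambda>_. 0"] by simp

lemma sc_uminus_one [simp]: "sc (\<lambda>_. - 1) = - 1"
  using sc_uminus[of "\<lambda>_. 1"] by simp

lemma tn_uminus_left: "tn (\<lambda>\<theta>. - a \<theta>) \<omega> = - tn a \<omega>"
  using tn_csc_left[of "\<lambda>_. - 1" a] by simp

lemma tn_uminus_right: "tn a (\<lambda>\<theta>. - \<omega> \<theta>) = - tn a \<omega>"
  using tn_csc_right[of a "\<lambda>_. - 1" \<omega>] by simp

lemma tn_diff_left: "tn (\<lambda>\<theta>. a \<theta> - b \<theta>) \<omega> = tn a \<omega> - tn b \<omega>"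
  using tn_add_left[of a "\<lambda>\<theta>. - b \<theta>"] by (simp add: tn_uminus_left)

lemma tn_diff_right: "tn a (\<lambda>\<theta>. \<omega> \<theta> - \<tau> \<theta>) = tn a \<omega> - tn a \<tau>"
  using tn_add_right[of a \<omega> "\<lambda>\<theta>. - \<tau> \<theta>"] by (simp add: tn_uminus_right)

lemma tn_sum_right: "tn a (\<lambda>\<theta>. \<Sum>i\<in>I. \<omega> i \<theta>) = (\<Sum>i\<in>I. tn a (\<omega> i))"
  by (induction I rule: infinite_finite_induct) (simp_all add: tn_add_right)

lemma rinv_rho [simp]: "rinv * rho = 1" "rho * rinv = 1"
  by (transfer, simp add: rhoinv_rho2 rho2_rhoinv)+

lemma dq_add: "dq (x + y) = dq x + dq y"
  and dq_mult: "dq (x * y) = dq x * y + gq x * dq y"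
  and dq_zero [simp]: "dq 0 = 0" and dq_one [simp]: "dq 1 = 0"
  and dq_tn: "dq (tn a \<omega>) = tn a (\<lambda>\<theta>. dform (\<omega> \<theta>))"
  and dq_dq [simp]: "dq (dq x) = 0"
  and dq_sc [simp]: "dq (sc c) = 0"
  and dq_rinv: "dq rinv = - (rinv * dq rho * rinv)"
  by (transfer; simp add: dE_linear dE_mult dE_dE)+

lemma gq_add: "gq (x + y) = gq x + gq y"
  and gq_mult: "gq (x * y) = gq x * gq y" and gq_zero [simp]: "gq 0 = 0"
  and gq_one [simp]: "gq 1 = 1" and gq_tn: "gq (tn a \<omega>) = tn a (\<lambda>\<theta>. fgrade (\<omega> \<theta>))"
  and gq_sc [simp]: "gq (sc c) = sc c" and gq_rinv [simp]: "gq rinv = rinv"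
  and gq_rho [simp]: "gq rho = rho"
  by (transfer; simp add: grE_linear grE_mult)+

lemma dq_sum: "dq (sum f I) = (\<Sum>i\<in>I. dq (f i))"
  by (induction I rule: infinite_finite_induct) (simp_all add: dq_add)

lemma gq_sum: "gq (sum f I) = (\<Sum>i\<in>I. gq (f i))"
  by (induction I rule: infinite_finite_induct) (simp_all add: gq_add)

section \<open>Weights and commutation up to phases\<close>

lemma mu_nonzero [simp]: "mu \<theta> \<noteq> 0"
  by (simp add: mu_def)

lemma mu_cis: "mu \<theta> = cis (pi * \<theta>)"
  by (simp add: mu_def cis_conv_exp mult.commute)

lemma cnj_mu: "cnj (mu \<theta>) = inverse (mu \<theta>)"
by (simp add: mu_cis cis_cnj)

definition ph :: "int \<Rightarrow> fam" where
  "ph n = sc (\<lambda>\<theta>. mu \<theta> powi n)"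

lemma ph_zero [simp]: "ph 0 = 1"
  by (simp add: ph_def)

lemma ph_mult [simp]: "ph m * ph n = ph (m + n)"
  by (simp add: ph_def power_int_add)

lemma ph_mult_left [simp]: "ph m * (ph n * x) = ph (m + n) * x"
  by (simp flip: mult.assoc)

lemma ph_commute: "x * ph n = ph n * x" and ph_left_commute: "x * (ph n * y) = ph n * (x * y)"
  by (simp_all add: ph_def sc_commute sc_left_commute)

definition sg :: "nat \<Rightarrow> fam" where
  "sg b = (if even b then 1 else - 1)"

text \<open>Commutation up to the phase \<open>mu \<theta>\<close> to the power n and the sign
  (-1)^b. Both exponents are additive in products, so commutation of composite expressions becomes
  integer arithmetic.\<close>

definition com :: "int \<Rightarrow> nat \<Rightarrow> fam \<Rightarrow> fam \<Rightarrow> bool" where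
  "com n b x y \<longleftrightarrow> x * y = ph n * (sg b * (y * x))"

lemma sg_mult_left [simp]: "sg b * (sg c * x) = sg (b + c) * x"
  by (simp add: sg_def)

lemma sg_left_commute: "x * (sg b * y) = sg b * (x * y)"
  by (simp add: sg_def)

lemma com_mult_right:
  assumes "com m b x y" "com n c x z"
  shows "com (m + n) (b + c) x (y * z)"
proof -
  have "x * (y * z) = (x * y) * z"
    by (simp only: mult.assoc)
  also have "\<dots> = ph m * (sg b * (y * (x * z)))"
    using assms(1) by (simp only: com_def mult.assoc)
  also have "\<dots> = ph m * (sg b * (ph n * (sg c * (y * z * x))))"
    using assms(2) by (simp only: com_def mult.assoc ph_left_commute[of y] sg_left_commute[of y])
  also have "\<dots> = ph (m + n) * (sg (b + c) * (y * z * x))"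
    by (simp only: ph_left_commute[of "sg b"] ph_mult_left sg_mult_left)
  finally show ?thesis
    by (simp only: com_def)
qed

lemma sg_double [simp]: "sg (b + b) = 1"
  by (simp add: sg_def)

lemma com_sym:
  assumes "com m b x y"
  shows "com (- m) b y x"
proof -
  have "ph (- m) * (sg b * (x * y)) = ph (- m + m) * (sg (b + b) * (y * x))"
    using assms by (simp only: com_def ph_left_commute[of "sg b"] ph_mult_left sg_mult_left)
  then show ?thesis
    by (simp add: com_def)
qed

lemma com_mult_left:
  assumes "com m b x z" "com n c y z"
  shows "com (m + n) (b + c) (x * y) z"
  using com_sym[OF com_mult_right[OF com_sym[OF assms(1)] com_sym[OF assms(2)]]] by (simp add: add.commute)

lemma com_zero [simp]: "com m b 0 x" "com m b x 0"
  by (simp_all add: com_def)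

lemma com_add: "com m b x y \<Longrightarrow> com m b x z \<Longrightarrow> com m b x (y + z)"
  by (simp add: com_def distrib_left distrib_right)

lemma com_sum_right: "(\<And>i. i \<in> I \<Longrightarrow> com m b x (f i)) \<Longrightarrow> com m b x (sum f I)"
  by (induction I rule: infinite_finite_induct) (simp_all add: com_add)

lemma com_sum_left: "(\<And>i. i \<in> I \<Longrightarrow> com m b (f i) x) \<Longrightarrow> com m b (sum f I) x"
  by (induction I rule: infinite_finite_induct) (simp_all add: com_def distrib_left distrib_right)

lemma com_uminus [simp]: "com m b (- x) y = com m b x y" "com m b x (- y) = com m b x y"
  by (simp_all add: com_def)

lemma com_sc [simp]: "com 0 0 (sc c) x" "com 0 0 x (sc c)" "com 0 0 (ph n) x" "com 0 0 x (ph n)"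
  by (simp_all add: com_def sg_def sc_commute ph_commute)

lemma com_sc_mult_left: "com m b x y \<Longrightarrow> com m b (sc c * x) y"
  using com_mult_left[OF com_sc(1), of m b x y c] by simp

lemma com_ph_mult_left: "com m b x y \<Longrightarrow> com m b (ph n * x) y"
  using com_mult_left[OF com_sc(3), of m b x y n] by simp

lemma com_trivial: "com 0 0 x y \<longleftrightarrow> x * y = y * x"
  by (simp add: com_def sg_def)

definition gw :: "nat \<Rightarrow> int" where "gw i = [1, 0, 0, 1] ! (i - 1)"
definition hw :: "nat \<Rightarrow> int" where "hw i = [1, 0, 1, 0] ! (i - 1)"

text \<open>
  The spinor weight of the index \<open>k\<close> is \<open>(gw k - 1/2, hw k - 1/2)\<close>; \<open>wd\<close> is twice the
  determinant of two such weights.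
\<close>

definition wd :: "nat \<Rightarrow> nat \<Rightarrow> int" where
  "wd k l = 2 * gw k * hw l - gw k - hw l - 2 * hw k * gw l + hw k + gw l"

text \<open>The index partner under the quaternionic structure: up to sign, the adjoint of an entry
  of A is the entry with both indices replaced by their partners. On spinor weights it is negation,
  whence \<open>wd_br\<close>.\<close>

definition br :: "nat \<Rightarrow> nat" where "br i = [2, 1, 4, 3] ! (i - 1)"

lemma wd_values [simp]:
  "wd 1 2 = 0" "wd 2 1 = 0" "wd 3 4 = 0" "wd 4 3 = 0"
  "wd 1 3 = 1" "wd 1 4 = - 1" "wd 2 3 = - 1" "wd 2 4 = 1"
  "wd 3 1 = - 1" "wd 4 1 = 1" "wd 3 2 = 1" "wd 4 2 = - 1" "wd i i = 0"
  by (simp_all add: wd_def gw_def hw_def)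

lemma wd_swap: "wd l k = - wd k l"
  by (simp add: wd_def)

lemma br_values [simp]: "br 1 = 2" "br 2 = 1" "br 3 = 4" "br 4 = 3"
  by (simp_all add: br_def)

lemma br_index: "k \<in> {1..4} \<Longrightarrow> br k \<in> {1..4}"
  by (erule index_cases) simp_all

lemma br_br: "k \<in> {1..4} \<Longrightarrow> br (br k) = k"
  by (erule index_cases) simp_all

lemma wd_br: "k \<in> {1..4} \<Longrightarrow> wd (br k) l = - wd k l" "k \<in> {1..4} \<Longrightarrow> wd l (br k) = - wd l k"
  by (erule index_cases; simp add: wd_def gw_def hw_def)+

lemma eta_eq:
  assumes "i \<in> {1..4}" "j \<in> {1..4}"
  shows "eta \<theta> i j = mu \<theta> powi (- wd i j)"
  by (rule index_cases[OF assms(1)]; rule index_cases[OF assms(2)])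
    (simp_all add: eta_def cnj_mu power_int_minus)

lemma sl_adj_single_gen: "sl_adj (gen (c, b)) = gen (c, \<not> b)" "sl_adj (- gen (c, b)) = - gen (c, \<not> b)"
  by (simp_all add: sl_adj_def gen_def single_uminus [symmetric])

lemma sl_adj_Amat:
  assumes "i \<in> {1..4}" "j \<in> {1..4}"
  shows "sl_adj (Amat i j) = (if even (i + j) then Amat (br i) (br j) else - Amat (br i) (br j))"
  by (rule index_cases[OF assms(1)]; rule index_cases[OF assms(2)])
    (simp_all add: Amat_def st_def unst_def sl_adj_single_gen)

definition idx :: "nat set" where "idx = {1..4}"

text \<open>All matrices are extended by zero outside of the index range.\<close>

definition Aq :: "nat \<Rightarrow> nat \<Rightarrow> fam" where
  "Aq i k = (if i \<in> idx \<and> k \<in> idx then tn (\<lambda>_. Amat i k) (\<lambda>_. fone) else 0)"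

definition As :: "nat \<Rightarrow> nat \<Rightarrow> fam" where
  "As i k = (if i \<in> idx \<and> k \<in> idx then tn (\<lambda>_. sl_adj (Amat i k)) (\<lambda>_. fone) else 0)"

definition fq :: "(real \<Rightarrow> form) \<Rightarrow> fam" where
  "fq \<omega> = tn (\<lambda>_. 1) \<omega>"

text \<open>The number b is the form degree, 0 for p and 1 for dp. It doubles as sign exponent in
  \<open>com\<close>, so that p and dp are treated together.\<close>

definition pq :: "nat \<Rightarrow> nat \<Rightarrow> nat \<Rightarrow> fam" where
  "pq b k l = (if k \<in> idx \<and> l \<in> idx
     then fq (\<lambda>\<theta>. if b = 0 then pmat \<theta> k l else dform (pmat \<theta> k l)) else 0)"

lemma tprod_fone [simp]: "tprod \<theta> fone w = w" "tprod \<theta> w fone = w"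
proof -
  have "tprod \<theta> fone (Poly_Mapping.single (m, S) a) = Poly_Mapping.single (m, S) a"
    "tprod \<theta> (Poly_Mapping.single (m, S) a) fone = Poly_Mapping.single (m, S) a" for m S a
    by (simp_all add: fone_def tprod_single wedge_mono_eq)
  then show "tprod \<theta> fone w = w" "tprod \<theta> w fone = w"
    by (induction w rule: poly_mapping_single_induct) (auto simp: tprod_linear)
qed

lemma tn_split: "tn a \<omega> = tn a (\<lambda>_. fone) * fq \<omega>" and tn_split': "fq \<omega> * tn a (\<lambda>_. fone) = tn a \<omega>"
  by (simp_all add: fq_def tn_mult)

lemma fq_mult: "fq \<omega> * fq \<tau> = fq (\<lambda>\<theta>. tprod \<theta> (\<omega> \<theta>) (\<tau> \<theta>))"
  by (simp add: fq_def tn_mult)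

text \<open>The defining relations of the matrix algebra, with the entries of \<open>eta\<close>
  turned into exponents; commutation involving adjoints is derived from it through
  \<open>As_eq\<close>.\<close>

lemma com_A_A: "com (- wd k i - wd j l) 0 (Aq i j) (Aq k l)"
proof (cases "i \<in> idx \<and> j \<in> idx \<and> k \<in> idx \<and> l \<in> idx")
  case True
  then have ix: "i \<in> {1..4}" "j \<in> {1..4}" "k \<in> {1..4}" "l \<in> {1..4}"
    by (auto simp: idx_def)
  have "tn (\<lambda>\<theta>. Amat i j * Amat k l - csc (eta \<theta> k i * eta \<theta> j l) (Amat k l * Amat i j)) (\<lambda>_. fone) = 0"
    unfolding SL_ideal_def
    by (rule tn_ideal_left, unfold SL_ideal_def, rule two_sided_ideal_generator) (use ix in \<open>auto simp: M_rel_def\<close>)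
  moreover have "eta \<theta> k i * eta \<theta> j l = mu \<theta> powi (- wd k i - wd j l)" for \<theta>
    using power_int_add[of "mu \<theta>" "- wd k i" "- wd j l"] unfolding eta_eq[OF ix(3,1)] eta_eq[OF ix(2,4)] by simp
  ultimately show ?thesis
    using True by (simp add: com_def sg_def Aq_def tn_mult tn_diff_left tn_csc_left ph_def)
qed (auto simp: Aq_def)

lemma As_eq: "As i k = (if i \<in> idx \<and> k \<in> idx then sg (i + k) * Aq (br i) (br k) else 0)"
  using br_index by (auto simp: As_def Aq_def idx_def sl_adj_Amat sg_def tn_uminus_left)

lemma com_As_A: "com (wd k i + wd j l) 0 (As i j) (Aq k l)"
proof (cases "i \<in> idx \<and> j \<in> idx")
  case True
  then show ?thesis
    using com_A_A[of k "br i" "br j" l] by (simp add: As_eq sg_def wd_br idx_def)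
qed (auto simp: As_eq)

lemma com_A_As: "com (wd k i + wd j l) 0 (Aq i j) (As k l)"
  using com_sym[OF com_As_A[of i k l j]] by (simp add: wd_swap[of k i] wd_swap[of j l])

lemma com_As_As: "com (- wd k i - wd j l) 0 (As i j) (As k l)"
proof (cases "k \<in> idx \<and> l \<in> idx")
  case True
  then show ?thesis
    using com_As_A[of "br k" i j "br l"] by (simp add: As_eq[of k] sg_def wd_br idx_def)
qed (auto simp: As_eq[of k])

lemma com_A_f: "com 0 0 (Aq i j) (fq \<omega>)" and com_As_f: "com 0 0 (As i j) (fq \<omega>)"
  by (simp_all add: com_trivial Aq_def As_def tn_split' flip: tn_split)

lemma com_A_p: "com 0 0 (Aq i j) (pq b k l)" and com_As_p: "com 0 0 (As i j) (pq b k l)"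
  by (simp_all add: pq_def com_A_f com_As_f)

lemma twist_eq: "twist \<theta> r s = mu \<theta> powi (fst r * snd s - snd r * fst s)"
  unfolding mu_cis cis_power_int by (simp add: twist_def cis_conv_exp mult_ac)

definition homog :: "int \<times> int \<Rightarrow> nat \<Rightarrow> form \<Rightarrow> bool" where
  "homog r b \<omega> \<longleftrightarrow> (\<forall>k\<in>Poly_Mapping.keys \<omega>. bideg k = r \<and> card (snd k) = b)"

text \<open>The twist is inverted when its arguments are exchanged, so the two orders differ by its
  square; this is the factor 2 in the exponent.\<close>

lemma tprod_homog:
  assumes "homog r b \<omega>" "homog s c \<tau>"
  shows "tprod \<theta> \<omega> \<tau> = csc (mu \<theta> powi (2 * (fst r * snd s - snd r * fst s)) * (- 1) ^ (b * c)) (tprod \<theta> \<tau> \<omega>)"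
proof -
  let ?n = "fst r * snd s - snd r * fst s"
  have tw: "twist \<theta> r s = mu \<theta> powi ?n"
    by (rule twist_eq)
  have tw': "twist \<theta> s r = mu \<theta> powi (- ?n)"
    unfolding twist_eq minus_diff_eq by (simp add: mult.commute)
  have 1: "csc (Poly_Mapping.lookup \<omega> k * Poly_Mapping.lookup \<tau> l) (csc (twist \<theta> (bideg k) (bideg l)) (wedge_mono k l))
     = csc (mu \<theta> powi (2 * ?n) * (- 1) ^ (b * c))
        (csc (Poly_Mapping.lookup \<tau> l * Poly_Mapping.lookup \<omega> k) (csc (twist \<theta> (bideg l) (bideg k)) (wedge_mono l k)))"
    if "k \<in> Poly_Mapping.keys \<omega>" "l \<in> Poly_Mapping.keys \<tau>" for k l
  proof -
    have k: "bideg k = r" "card (snd k) = b" and l: "bideg l = s" "card (snd l) = c"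
      using assms that by (auto simp: homog_def)
    have "wedge_mono k l = csc ((- 1) ^ (b * c)) (wedge_mono l k)"
      using wedge_mono_commute[of "fst k" "snd k" "fst l" "snd l"] k l by simp
    moreover have "mu \<theta> powi ?n = mu \<theta> powi (2 * ?n) * mu \<theta> powi (- ?n)"
      by (subst power_int_add [symmetric]) (simp_all add: algebra_simps)
    ultimately show ?thesis
      by (simp add: k(1) l(1) tw tw' mult_ac)
  qed
  show ?thesis
    unfolding tprod_def bilin_ext_def csc_sum
    by (subst sum.swap) (intro sum.cong refl 1)
qed

lemma com_homog:
  assumes "\<And>\<theta>. homog r b (\<omega> \<theta>)" "\<And>\<theta>. homog s c (\<tau> \<theta>)"
  shows "com (2 * (fst r * snd s - snd r * fst s)) (b * c) (fq \<omega>) (fq \<tau>)"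
proof -
  have "fq \<omega> * fq \<tau> = tn (\<lambda>_. 1) (\<lambda>\<theta>. csc (mu \<theta> powi (2 * (fst r * snd s - snd r * fst s)) * (- 1) ^ (b * c)) (tprod \<theta> (\<tau> \<theta>) (\<omega> \<theta>)))"
    using tprod_homog[OF assms] by (simp add: fq_mult) (simp add: fq_def)
  also have "\<dots> = sc (\<lambda>\<theta>. mu \<theta> powi (2 * (fst r * snd s - snd r * fst s))) * (sc (\<lambda>_. (- 1) ^ (b * c)) * (fq \<tau> * fq \<omega>))"
    by (simp add: tn_csc_right fq_mult) (simp add: fq_def)
  also have "sc (\<lambda>_. (- 1) ^ (b * c)) = sg (b * c)"
    by (cases "even (b * c)") (simp_all add: sg_def)
  finally show ?thesis
    by (simp add: com_def ph_def)
qed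

lemma homog_csc: "homog r b \<omega> \<Longrightarrow> homog r b (csc c \<omega>)"
proof -
  have "Poly_Mapping.keys (csc c \<omega>) \<subseteq> Poly_Mapping.keys \<omega>"
    by (auto simp: in_keys_iff)
  then show "homog r b \<omega> \<Longrightarrow> homog r b (csc c \<omega>)"
    unfolding homog_def by blast
qed

lemma homog_add: "homog r b \<omega> \<Longrightarrow> homog r b \<tau> \<Longrightarrow> homog r b (\<omega> + \<tau>)"
  unfolding homog_def using Poly_Mapping.keys_add[of \<omega> \<tau>] by blast

lemma homog_diff: "homog r b \<omega> \<Longrightarrow> homog r b \<tau> \<Longrightarrow> homog r b (\<omega> - \<tau>)"
  using homog_add[OF _ homog_csc[of r b \<tau> "- 1"], of \<omega>] by simp

lemma homog_uminus: "homog r b \<omega> \<Longrightarrow> homog r b (- \<omega>)"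
  using homog_csc[of r b \<omega> "- 1"] by simp

lemma homog_zero: "homog r b 0"
  by (simp add: homog_def)

lemmas homog_linear = homog_csc homog_add homog_diff homog_uminus homog_zero

lemma dform_var: "dform (var c) = Poly_Mapping.single (\<lambda>_. 0, {c}) 1"
proof -
  have "dterm ((\<lambda>_. 0)(c := 1)) {} b = (if b = c then Poly_Mapping.single (\<lambda>_. 0, {c}) 1 else 0)" for b
    by (auto simp: dterm_def fun_upd_def intro!: arg_cong[where f="\<lambda>m. Poly_Mapping.single (m, {c}) 1"])
  then show ?thesis
    by (simp add: var_def dform_single)
qed

lemma bideg_var: "bideg ((\<lambda>_. 0)(c := 1), {}) = bideg_coord c" "bideg (\<lambda>_. 0, {c}) = bideg_coord c"
proof -
  have "(int (((\<lambda>_. 0)(c := 1)) b) + of_bool (b \<in> {})) * z = (if b = c then z else 0)"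
    "(int 0 + of_bool (b \<in> {c})) * z = (if b = c then z else 0)" for b z
    by auto
  then show "bideg ((\<lambda>_. 0)(c := 1), {}) = bideg_coord c" "bideg (\<lambda>_. 0, {c}) = bideg_coord c"
    unfolding bideg_eq by simp_all
qed

lemma homog_var: "homog (bideg_coord c) 0 (var c)" "homog (bideg_coord c) 1 (dform (var c))"
  by (auto simp: homog_def dform_var bideg_var) (auto simp: var_def bideg_var)

lemma homog_var_cases:
  "homog (0, 0) 0 (var X)" "homog (1, 0) 0 (var Al)" "homog (- 1, 0) 0 (var Als)"
  "homog (0, 1) 0 (var Be)" "homog (0, - 1) 0 (var Bes)"
  "homog (0, 0) 1 (dform (var X))" "homog (1, 0) 1 (dform (var Al))" "homog (- 1, 0) 1 (dform (var Als))"
  "homog (0, 1) 1 (dform (var Be))" "homog (0, - 1) 1 (dform (var Bes))"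
  using homog_var[of X] homog_var[of Al] homog_var[of Als] homog_var[of Be] homog_var[of Bes]
  by simp_all

lemma homog_fone: "homog (0, 0) 0 fone"
  by (simp add: homog_def fone_def)

lemma homog_pmat:
  assumes "k \<in> {1..4}" "l \<in> {1..4}"
  shows "homog (gw k - gw l, hw k - hw l) 0 (pmat \<theta> k l)"
    "homog (gw k - gw l, hw k - hw l) 1 (dform (pmat \<theta> k l))"
proof -
  have d: "dform (csc c \<omega>) = csc c (dform \<omega>)" "dform (fone + \<omega>) = dform \<omega>"
    "dform (fone - \<omega>) = csc (- 1) (dform \<omega>)" for c \<omega>
    by (simp_all add: dform_linear)
  have w: "gw 1 = 1" "gw 2 = 0" "gw 3 = 0" "gw 4 = 1" "hw 1 = 1" "hw 2 = 0" "hw 3 = 1" "hw 4 = 0"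
    by (simp_all add: gw_def hw_def)
  show "homog (gw k - gw l, hw k - hw l) 0 (pmat \<theta> k l)"
    by (rule index_cases[OF assms(1)]; rule index_cases[OF assms(2)])
      (simp_all only: pmat_eqs w, auto intro!: homog_linear homog_var_cases(1-5) homog_fone)
  show "homog (gw k - gw l, hw k - hw l) 1 (dform (pmat \<theta> k l))"
    by (rule index_cases[OF assms(1)]; rule index_cases[OF assms(2)])
      (simp_all only: pmat_eqs w d dform_zero, auto intro!: homog_linear homog_var_cases(6-10))
qed

lemma com_p_p: "com (wd m k - wd m l - wd n k + wd n l) (b * c) (pq b m n) (pq c k l)"
  if "b \<le> 1" "c \<le> 1"
proof (cases "m \<in> idx \<and> n \<in> idx \<and> k \<in> idx \<and> l \<in> idx")
  case True
  have 1: "homog (gw k - gw l, hw k - hw l) b (if b = 0 then pmat \<theta> k l else dform (pmat \<theta> k l))"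
    if "k \<in> idx" "l \<in> idx" "b \<le> 1" for k l b \<theta>
  proof -
    have "b = 0 \<or> b = 1"
      using that by linarith
    then show ?thesis
      using that homog_pmat[of k l \<theta>] unfolding idx_def by (elim disjE) simp_all
  qed
  \<comment> \<open>Bilinearity of the determinant, applied to differences of spinor weights; the
    half-integral shifts cancel.\<close>
  have "wd m k - wd m l - wd n k + wd n l
      = 2 * ((gw m - gw n) * (hw k - hw l) - (hw m - hw n) * (gw k - gw l))"
    by (simp add: wd_def algebra_simps)
  with that True com_homog[OF 1[of m n b] 1[of k l c]] show ?thesis
    by (simp add: pq_def)
qed (auto simp: pq_def)

lemma sum_idx: "(\<Sum>i\<in>idx. f i) = f 1 + f 2 + f 3 + (f 4 :: 'a :: comm_monoid_add)"
proof -
  have idx: "idx = {1, 2, 3, 4}"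
    by (auto simp: idx_def)
  show ?thesis
    unfolding idx by (simp add: add.assoc)
qed

lemma idx_values [simp]: "1 \<in> idx" "2 \<in> idx" "3 \<in> idx" "4 \<in> idx"
  by (simp_all add: idx_def)

lemma idx_cases: "k \<in> idx \<Longrightarrow> (k = 1 \<Longrightarrow> P) \<Longrightarrow> (k = 2 \<Longrightarrow> P) \<Longrightarrow> (k = 3 \<Longrightarrow> P) \<Longrightarrow> (k = 4 \<Longrightarrow> P) \<Longrightarrow> P"
  unfolding idx_def by (erule index_cases)

lemma sum_br: "(\<Sum>i\<in>idx. f (br i)) = (\<Sum>i\<in>idx. f i :: 'a :: comm_monoid_add)"
  by (simp add: sum_idx ac_simps)

section \<open>The quaternionic hermitian matrix H\<close>

definition H :: "nat \<Rightarrow> nat \<Rightarrow> fam" where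
  "H l k = (\<Sum>i\<in>idx. As i l * Aq i k)"

text \<open>The phases of the row indices cancel between the adjoint entry and the entry in each
  summand of H; only column indices survive, so the exponent is the same for all summands.\<close>

lemma com_H_A: "com (wd n k - wd m k) 0 (H n m) (Aq i k)"
proof -
  have "com (wd n k - wd m k) 0 (As j n * Aq j m) (Aq i k)" for j
    using com_mult_left[OF com_As_A[of i j n k] com_A_A[of i j m k]] by simp
  then show ?thesis
    unfolding H_def by (intro com_sum_left)
qed

lemma com_H_As: "com (wd m k - wd n k) 0 (H n m) (As i k)"
proof -
  have "com (wd m k - wd n k) 0 (As j n * Aq j m) (As i k)" for j
    using com_mult_left[OF com_As_As[of i j n k] com_A_As[of i j m k]] by simp
  then show ?thesis
    unfolding H_def by (intro com_sum_left)
qed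

lemma com_H_H: "com (wd m l - wd n l + (wd n k - wd m k)) 0 (H n m) (H l k)"
  using com_sum_right[of idx _ 0 "H n m" "\<lambda>i. As i l * Aq i k"] com_mult_right[OF com_H_As com_H_A]
  unfolding H_def[of l k] by simp

lemma com_H_f: "com 0 0 (H n m) (fq \<omega>)"
  unfolding H_def using com_mult_left[OF com_As_f com_A_f] by (intro com_sum_left) simp

text \<open>The deformed statement that H is quaternionic hermitian. Passing to partner indices
  exchanges, up to sign, entries with adjoints; restoring the order of the two factors costs
  \<open>ph (wd k l)\<close>, since row i and its partner contribute the exponent 0.\<close>

lemma H_br:
  assumes "k \<in> idx" "l \<in> idx"
  shows "H (br k) (br l) = ph (wd k l) * (sg (k + l) * H l k)"
proof -
  have par: "sg (br i + br j) = sg (i + j)" if "i \<in> idx" "j \<in> idx" for i j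
    by (rule idx_cases[OF that(1)]; rule idx_cases[OF that(2)]) (simp_all add: sg_def)
  have br: "br i \<in> idx" "br (br i) = i" if "i \<in> idx" for i
    using that br_index br_br by (simp_all add: idx_def)
  have "As (br i) (br k) * Aq (br i) (br l) = ph (wd k l) * (sg (k + l) * (As i l * Aq i k))" if "i \<in> idx" for i
  proof -
    have 1: "As (br i) (br k) * Aq (br i) (br l) = sg (i + k) * (Aq i k * Aq (br i) (br l))"
      using that assms par by (simp add: As_eq br mult.assoc)
    have 2: "Aq (br i) (br l) = sg (i + l) * As i l"
      using that assms by (simp add: As_eq sg_def)
    have "Aq i k * Aq (br i) (br l) = ph (wd k l) * (Aq (br i) (br l) * Aq i k)"
      using com_A_A[of "br i" i k "br l"] that assms by (simp add: com_def wd_br idx_def sg_def)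
    also have "\<dots> = ph (wd k l) * (sg (i + l) * As i l * Aq i k)"
      by (simp only: 2)
    finally have "As (br i) (br k) * Aq (br i) (br l) = ph (wd k l) * (sg (i + k + (i + l)) * (As i l * Aq i k))"
      unfolding 1 by (simp only: ph_left_commute[of "sg (i + k)"] sg_mult_left mult.assoc)
    also have "sg (i + k + (i + l)) = sg (k + l)"
      by (auto simp: sg_def)
    finally show ?thesis .
  qed
  then have "(\<Sum>i\<in>idx. As (br i) (br k) * Aq (br i) (br l)) = ph (wd k l) * (sg (k + l) * H l k)"
    by (simp add: H_def sum_distrib_left)
  then show ?thesis
    using sum_br[of "\<lambda>i. As i (br k) * Aq i (br l)"] by (simp add: H_def)
qed

text \<open>Leaves the six independent entries H 1 1, H 3 3, H 1 3, H 3 1, H 1 4 and H 4 1: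
  undeformed, two real diagonal blocks and one quaternion together with its conjugate.\<close>

lemma H_values:
  "H 1 2 = 0" "H 2 1 = 0" "H 3 4 = 0" "H 4 3 = 0" "H 2 2 = H 1 1" "H 4 4 = H 3 3"
  "H 2 4 = ph 1 * H 3 1" "H 4 2 = ph (- 1) * H 1 3" "H 3 2 = - (ph 1 * H 1 4)" "H 2 3 = - (ph (- 1) * H 4 1)"
proof -
  have "H 1 2 = - H 1 2" "H 2 1 = - H 2 1" "H 3 4 = - H 3 4" "H 4 3 = - H 4 3"
    using H_br[of 2 1] H_br[of 1 2] H_br[of 3 4] H_br[of 4 3] by (simp_all add: sg_def)
  then show "H 1 2 = 0" "H 2 1 = 0" "H 3 4 = 0" "H 4 3 = 0"
    by (metis half_cancel neg_eq_iff_add_eq_0)+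
  show "H 2 2 = H 1 1" "H 4 4 = H 3 3" "H 2 4 = ph 1 * H 3 1" "H 4 2 = ph (- 1) * H 1 3"
    "H 3 2 = - (ph 1 * H 1 4)" "H 2 3 = - (ph (- 1) * H 4 1)"
    using H_br[of 1 1] H_br[of 3 3] H_br[of 1 3] H_br[of 3 1] H_br[of 4 1] H_br[of 1 4]
    by (simp_all add: sg_def)
qed

section \<open>Normal forms and the two matrix identities\<close>

definition vq :: "coord \<Rightarrow> fam" where
  "vq c = fq (\<lambda>_. var c)"

definition half :: fam where
  "half = sc (\<lambda>_. 1 / 2)"

lemma half_double: "half * (x + x) = x"
proof -
  have "half * (x + x) = sc (\<lambda>_. 1 / 2 + 1 / 2) * x"
    unfolding half_def sc_add by (simp add: distrib_left distrib_right)
  then show ?thesis by simp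
qed

lemma half_add: "half * x + half * x = x"
  using half_double[of x] by (simp add: distrib_left)

lemma fq_linear:
  "fq (\<lambda>\<theta>. csc (c \<theta>) (\<omega> \<theta>)) = sc c * fq \<omega>" "fq (\<lambda>\<theta>. \<omega> \<theta> + \<tau> \<theta>) = fq \<omega> + fq \<tau>"
  "fq (\<lambda>\<theta>. \<omega> \<theta> - \<tau> \<theta>) = fq \<omega> - fq \<tau>" "fq (\<lambda>_. fone) = 1" "fq (\<lambda>_. 0) = 0"
  by (simp_all add: fq_def tn_csc_right tn_add_right tn_diff_right tn_one)

lemma half_ph: "sc (\<lambda>\<theta>. mu \<theta> / 2) = half * ph 1" "sc (\<lambda>\<theta>. cnj (mu \<theta>) / 2) = half * ph (- 1)"
  "sc (\<lambda>\<theta>. - mu \<theta> / 2) = - (half * ph 1)" "sc (\<lambda>\<theta>. - cnj (mu \<theta>) / 2) = - (half * ph (- 1))"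
  unfolding half_def ph_def sc_mult sc_uminus [symmetric]
  by (simp_all add: cnj_mu power_int_minus)

lemma pq_values:
  "pq 0 1 1 = half * (1 + vq X)" "pq 0 1 2 = 0" "pq 0 1 3 = half * vq Al" "pq 0 1 4 = half * vq Be"
  "pq 0 2 1 = 0" "pq 0 2 2 = half * (1 + vq X)" "pq 0 2 3 = - (half * (ph 1 * vq Bes))"
  "pq 0 2 4 = half * (ph (- 1) * vq Als)"
  "pq 0 3 1 = half * vq Als" "pq 0 3 2 = - (half * (ph (- 1) * vq Be))" "pq 0 3 3 = half * (1 - vq X)" "pq 0 3 4 = 0"
  "pq 0 4 1 = half * vq Bes" "pq 0 4 2 = half * (ph 1 * vq Al)" "pq 0 4 3 = 0" "pq 0 4 4 = half * (1 - vq X)"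
  by (simp_all only: pq_def idx_values simp_thms if_True pmat_eqs fq_linear half_ph mult.assoc mult_minus_left
      flip: half_def vq_def)

lemma com_vq: "com (2 * (fst (bideg_coord b) * snd (bideg_coord c) - snd (bideg_coord b) * fst (bideg_coord c))) 0
    (vq b) (vq c)"
  using com_homog[of "bideg_coord b" 0 "\<lambda>_. var b" "bideg_coord c" 0 "\<lambda>_. var c"]
  by (simp add: homog_var vq_def)

lemma com_swap: "com n 0 y x \<Longrightarrow> y * x = ph n * (x * y)" "com n 0 y x \<Longrightarrow> y * (x * z) = ph n * (x * (y * z))"
proof -
  assume "com n 0 y x"
  then show 1: "y * x = ph n * (x * y)"
    by (simp add: com_def sg_def)
  show "y * (x * z) = ph n * (x * (y * z))"
    unfolding mult.assoc [symmetric] 1 by simp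
qed

lemmas vq_swaps =
  com_swap[OF com_vq[of Al X]]
  com_swap[OF com_vq[of Als X]]
  com_swap[OF com_vq[of Be X]]
  com_swap[OF com_vq[of Bes X]]
  com_swap[OF com_vq[of Als Al]]
  com_swap[OF com_vq[of Be Al]]
  com_swap[OF com_vq[of Bes Al]]
  com_swap[OF com_vq[of Be Als]]
  com_swap[OF com_vq[of Bes Als]]
  com_swap[OF com_vq[of Bes Be]]

text \<open>Oriented towards the order H 1 1, H 3 3, H 1 3, H 3 1, H 1 4, H 4 1; the exchange phases
  are computed from \<open>wd\<close>.\<close>

lemmas H_swaps =
  com_swap[OF com_H_H[where n=3 and m=3 and l=1 and k=1]]
  com_swap[OF com_H_H[where n=1 and m=3 and l=1 and k=1]]
  com_swap[OF com_H_H[where n=3 and m=1 and l=1 and k=1]]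
  com_swap[OF com_H_H[where n=1 and m=4 and l=1 and k=1]]
  com_swap[OF com_H_H[where n=4 and m=1 and l=1 and k=1]]
  com_swap[OF com_H_H[where n=1 and m=3 and l=3 and k=3]]
  com_swap[OF com_H_H[where n=3 and m=1 and l=3 and k=3]]
  com_swap[OF com_H_H[where n=1 and m=4 and l=3 and k=3]]
  com_swap[OF com_H_H[where n=4 and m=1 and l=3 and k=3]]
  com_swap[OF com_H_H[where n=3 and m=1 and l=1 and k=3]]
  com_swap[OF com_H_H[where n=1 and m=4 and l=1 and k=3]]
  com_swap[OF com_H_H[where n=4 and m=1 and l=1 and k=3]]
  com_swap[OF com_H_H[where n=1 and m=4 and l=3 and k=1]]
  com_swap[OF com_H_H[where n=4 and m=1 and l=3 and k=1]]
  com_swap[OF com_H_H[where n=4 and m=1 and l=1 and k=4]]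

lemma vq_H_swap: "vq c * H l k = H l k * vq c" "vq c * (H l k * z) = H l k * (vq c * z)"
  using com_swap[OF com_sym[OF com_H_f[of l k]]] by (simp_all add: vq_def)

lemma scalar_swaps:
  "H l k * ph n = ph n * H l k" "H l k * (ph n * z) = ph n * (H l k * z)"
  "vq c * ph n = ph n * vq c" "vq c * (ph n * z) = ph n * (vq c * z)"
  "H l k * half = half * H l k" "H l k * (half * z) = half * (H l k * z)"
  "vq c * half = half * vq c" "vq c * (half * z) = half * (vq c * z)"
  "ph n * half = half * ph n" "ph n * (half * z) = half * (ph n * z)"
  unfolding half_def
  by (rule ph_commute ph_left_commute sc_commute sc_left_commute)+

text \<open>Brings a product into the shape scalars, entries of H, coordinates, each group in a
  fixed order, so that identities between matrix entries become comparisons of terms.\<close>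

lemmas normal_form = vq_swaps H_swaps vq_H_swap scalar_swaps distrib_left distrib_right
  left_diff_distrib right_diff_distrib mult.assoc

text \<open>The sphere relation, oriented to eliminate \<alpha> times its adjoint. Conjugate
  coordinates have opposite bidegrees, so their mutual twist is trivial and the undeformed relation
  persists.\<close>

lemma sphere_eq: "vq Als * vq Al = 1 - vq X * vq X - vq Be * vq Bes"
  "vq Al * vq Als = 1 - vq X * vq X - vq Be * vq Bes"
proof -
  have "wedge (rsq - fone) fone + wedge rdr 0 = rsq - fone"
    by (simp add: wedge_eq_tprod)
  then have "rsq - fone \<in> sphere_ideal"
    unfolding sphere_ideal_def by (metis (mono_tags, lifting) mem_Collect_eq)
  then have "fq (\<lambda>_. rsq - fone) = 0"
    unfolding fq_def by (intro tn_ideal_right)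
  moreover have "tprod \<theta> (var c) (var (cbar c)) = wedge (var c) (var (cbar c))" for \<theta> c
    unfolding wedge_eq_tprod var_def tprod_single by (cases c) (simp_all add: bideg_var twist_def)
  from this[of _ X] this[of _ Al] this[of _ Be]
  have "fq (\<lambda>_. rsq) = vq X * vq X + vq Al * vq Als + vq Be * vq Bes"
    by (simp add: rsq_def fq_linear vq_def fq_mult)
  ultimately have "vq X * vq X + vq Al * vq Als + vq Be * vq Bes = 1"
    using fq_linear(3)[of "\<lambda>_. rsq" "\<lambda>_. fone"] by (simp add: fq_linear)
  then show 1: "vq Al * vq Als = 1 - vq X * vq X - vq Be * vq Bes"
    by (simp add: algebra_simps)
  show "vq Als * vq Al = 1 - vq X * vq X - vq Be * vq Bes"
    unfolding 1 [symmetric] using com_swap(1)[OF com_vq[of Als Al]] by simp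
qed

text \<open>
  \<open>\<rho>\<^sup>2\<close> does not commute with \<open>A\<^sub>i\<^sub>k p\<^sub>k\<^sub>l\<close>: moving it to the right multiplies its terms by phases that
  depend only on \<open>l\<close>, and the result is \<open>Dd l\<close>.
\<close>

definition Dd :: "nat \<Rightarrow> fam" where
  "Dd l = half * (\<Sum>m\<in>idx. \<Sum>n\<in>idx. ph (wd m n + wd n l - wd m l) * (H n m * pq 0 m n))"

text \<open>The quaternionic determinant of \<open>A\<^sup>* A\<close>.\<close>

definition xi :: fam where
  "xi = H 1 1 * H 3 3 - H 1 3 * H 3 1 - H 1 4 * H 4 1"

text \<open>The four values of \<open>Dd\<close> differ only in the phases of the off-diagonal
  terms; a belongs to \<alpha> and b to \<beta>.\<close>

definition Rr :: "int \<Rightarrow> int \<Rightarrow> fam" where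
  "Rr a b = H 1 1 + H 1 1 * vq X + H 3 3 - H 3 3 * vq X
     + (ph a * (H 3 1 * vq Al) + ph (- a) * (H 1 3 * vq Als) + ph b * (H 4 1 * vq Be) + ph (- b) * (H 1 4 * vq Bes))"

lemma Dd_values:
  "Dd 1 = half * Rr 0 0" "Dd 2 = half * Rr 2 (- 2)" "Dd 3 = half * Rr 0 (- 2)" "Dd 4 = half * Rr 2 0"
proof -
  \<comment> \<open>The pairs (m, n) and (br n, br m) contribute equally, so the double sum is
    \<open>half * (R + R)\<close>, with the factor \<open>half\<close> coming from p.\<close>
  have *: "(\<Sum>m\<in>idx. \<Sum>n\<in>idx. ph (wd m n + wd n l - wd m l) * (H n m * pq 0 m n)) = half * (R + R)
    \<Longrightarrow> Dd l = half * R" for l R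
    by (simp only: Dd_def half_double)
  show "Dd 1 = half * Rr 0 0" "Dd 2 = half * Rr 2 (- 2)" "Dd 3 = half * Rr 0 (- 2)" "Dd 4 = half * Rr 2 0"
    by (rule *, simp add: sum_idx H_values pq_values normal_form Rr_def)+
qed

text \<open>Undeformed, p is the projection onto a quaternionic line, and compressing a hermitian H
  to a line gives a real multiple of p. In the deformed case the multiple picks up phases depending
  on the column l.\<close>

lemma p_H_p:
  assumes "k \<in> idx" "l \<in> idx"
  shows "(\<Sum>m\<in>idx. (\<Sum>n\<in>idx. pq 0 k n * H n m) * pq 0 m l) = pq 0 k l * Dd l"
  by (rule idx_cases[OF assms(1)]; rule idx_cases[OF assms(2)])
    (simp_all add: sum_idx H_values pq_values normal_form Dd_values Rr_def sphere_eq)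

lemma p_p:
  assumes "k \<in> idx" "l \<in> idx"
  shows "(\<Sum>m\<in>idx. pq 0 k m * pq 0 m l) = pq 0 k l"
  \<comment> \<open>Terms on the left carry \<open>half\<close> twice; splitting the right side into
    two halves gives it terms of the same kind, since no rule of the normal form adds up
    halves.\<close>
  by (rule trans[OF _ half_add]; rule idx_cases[OF assms(1)]; rule idx_cases[OF assms(2)])
    (simp_all add: sum_idx pq_values normal_form sphere_eq)

text \<open>
  The polarised Cayley-Hamilton identity \<open>H q H = tr (H q) H - det H (tr q - q)\<close> of hermitian
  quaternionic \<open>2 \<times> 2\<close> matrices, for \<open>q = p\<close> with \<open>tr p = 1\<close>.
\<close>

lemma H_p_H:
  assumes "k \<in> idx" "l \<in> idx"
  shows "(\<Sum>m\<in>idx. (\<Sum>n\<in>idx. H k n * pq 0 n m) * H m l) = Dd k * H k l - xi * ((if k = l then 1 else 0) - pq 0 k l)"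
proof -
  \<comment> \<open>The unit is written as \<open>half * (1 + 1)\<close>, matching the factor
    \<open>half\<close> carried by the other terms.\<close>
  have "(\<Sum>m\<in>idx. (\<Sum>n\<in>idx. H k n * pq 0 n m) * H m l)
      = Dd k * H k l - xi * ((if k = l then half * (1 + 1) else 0) - pq 0 k l)"
    by (rule idx_cases[OF assms(1)]; rule idx_cases[OF assms(2)])
      (simp_all add: sum_idx pq_values H_values normal_form Dd_values Rr_def xi_def)
  then show ?thesis
    by (simp only: half_double)
qed

section \<open>Commutation with \<open>\<rho>\<^sup>2\<close>\<close>

text \<open>This is \<rho>^2 for b = 0 and its differential for b = 1 (\<open>rho_eq\<close>,
  \<open>dq_rho\<close>), so that one argument gives the commutation rules of both.\<close>

definition rr :: "nat \<Rightarrow> fam" where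
  "rr b = half * (\<Sum>m\<in>idx. \<Sum>n\<in>idx. ph (wd m n) * (H n m * pq b m n))"

lemma com_H_p: "com 0 0 (H n m) (pq b k l)" and com_p_H: "com 0 0 (pq b k l) (H n m)"
  using com_H_f com_sym[OF com_H_f] by (simp_all add: pq_def)

lemma com_eq: "com m b x y \<Longrightarrow> m = n \<Longrightarrow> b = c \<Longrightarrow> com n c x y"
  by simp

lemma com_half_mult: "com m b x y \<Longrightarrow> com m b (half * x) y"
  unfolding half_def by (rule com_sc_mult_left)

lemma com_rrI:
  assumes "\<And>n m. com 0 (b * c) (H n m * pq b m n) y"
  shows "com 0 (b * c) (rr b) y"
  unfolding rr_def by (intro com_half_mult com_sum_left com_ph_mult_left assms)

lemma com_Hp_A: "com (wd n k - wd m k) 0 (H n m * pq b m n) (Aq i k)"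
  by (rule com_eq[OF com_mult_left[OF com_H_A com_sym[OF com_A_p]]]) simp_all

lemma com_Hp_As: "com (wd m k - wd n k) 0 (H n m * pq b m n) (As i k)"
  by (rule com_eq[OF com_mult_left[OF com_H_As com_sym[OF com_As_p]]]) simp_all

lemma com_Hp_p:
  assumes "b \<le> 1" "c \<le> 1"
  shows "com (wd m k - wd m l - wd n k + wd n l) (b * c) (H n m * pq b m n) (pq c k l)"
  by (rule com_eq[OF com_mult_left[OF com_H_p com_p_p[OF assms]]]) simp_all

text \<open>The contributions of the contracted index k from A and from p cancel; a phase in the
  free index l remains.\<close>

lemma com_Hp_Ap:
  assumes "b \<le> 1" "c \<le> 1"
  shows "com (wd n l - wd m l) (b * c) (H n m * pq b m n) (Aq i k * pq c k l)"
  by (rule com_eq[OF com_mult_right[OF com_Hp_A com_Hp_p[OF assms]]]) simp_all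

text \<open>The phase in l left over by \<open>com_Hp_Ap\<close> is cancelled by the adjoint entry
  \<open>As j l\<close>. Only the sign of the form degrees remains.\<close>

lemma com_rr_Q:
  assumes "b \<le> 1" "c \<le> 1"
  shows "com 0 (b * c) (rr b) (\<Sum>l\<in>idx. (\<Sum>k\<in>idx. Aq i k * pq c k l) * As j l)"
proof (rule com_rrI)
  fix n m
  have row: "com (wd n l - wd m l) (b * c) (H n m * pq b m n) (\<Sum>k\<in>idx. Aq i k * pq c k l)" for l
    by (intro com_sum_right com_Hp_Ap assms)
  show "com 0 (b * c) (H n m * pq b m n) (\<Sum>l\<in>idx. (\<Sum>k\<in>idx. Aq i k * pq c k l) * As j l)"
    by (rule com_sum_right, rule com_eq[OF com_mult_right[OF row com_Hp_As]]) simp_all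
qed

lemma com_rr_rr:
  assumes "b \<le> 1" "c \<le> 1"
  shows "com 0 (b * c) (rr b) (rr c)"
proof (rule com_rrI)
  fix n m
  have H: "com (wd m l - wd n l + (wd n k - wd m k)) 0 (H n m * pq b m n) (H l k)" for l k
    by (rule com_eq[OF com_mult_left[OF com_H_H com_p_H]]) simp_all
  have "com 0 (b * c) (H n m * pq b m n) (H l k * pq c k l)" for l k
    by (rule com_eq[OF com_mult_right[OF H com_Hp_p[OF assms]]]) simp_all
  from com_sym[OF this]
  have "com 0 (b * c) (rr c) (H n m * pq b m n)"
    unfolding rr_def by (intro com_half_mult com_sum_left com_ph_mult_left) simp
  from com_sym[OF this] show "com 0 (b * c) (H n m * pq b m n) (rr c)"
    by simp
qed

lemma rr_mult_Ap:
  assumes "c \<le> 1"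
  shows "rr 0 * (Aq i k * pq c k l) = Aq i k * pq c k l * Dd l"
proof -
  have *: "H n m * pq 0 m n * (Aq i k * pq c k l)
      = ph (wd n l - wd m l) * (Aq i k * pq c k l * (H n m * pq 0 m n))" for n m
    using com_Hp_Ap[of 0 c n l m i k] assms by (simp add: com_def sg_def)
  have "rr 0 * (Aq i k * pq c k l) = half * (\<Sum>m\<in>idx. \<Sum>n\<in>idx. ph (wd m n) *
      (H n m * pq 0 m n * (Aq i k * pq c k l)))"
    by (simp only: rr_def sum_distrib_right mult.assoc)
  also have "\<dots> = half * (\<Sum>m\<in>idx. \<Sum>n\<in>idx. Aq i k * pq c k l *
      (ph (wd m n + wd n l - wd m l) * (H n m * pq 0 m n)))"
    unfolding * ph_mult_left ph_left_commute[of "Aq i k * pq c k l"] by (simp add: algebra_simps)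
  also have "\<dots> = Aq i k * pq c k l * Dd l"
    unfolding Dd_def sum_distrib_left [symmetric] half_def sc_left_commute ..
  finally show ?thesis .
qed

text \<open>In each of the three monomials of \<open>xi\<close> the exponents cancel: the entries of
  H are diagonal or have mutually exchanged indices.\<close>

lemma xi_commute: "xi * (Aq i k * pq c k l) = Aq i k * pq c k l * xi"
proof -
  have "com 0 0 (H l m * H m' l') (pq c k l'')" for l m l' m' l''
    by (rule com_eq[OF com_mult_left[OF com_H_p com_H_p]]) simp_all
  then have p: "com 0 0 xi (pq c k l)"
    by (simp add: xi_def com_trivial left_diff_distrib right_diff_distrib)
  have "com 0 0 (H 1 1 * H 3 3) (Aq i k)" "com 0 0 (H 1 3 * H 3 1) (Aq i k)" "com 0 0 (H 1 4 * H 4 1) (Aq i k)"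
    by (rule com_eq[OF com_mult_left[OF com_H_A com_H_A]]; simp)+
  then have A: "com 0 0 xi (Aq i k)"
    by (simp add: xi_def com_trivial left_diff_distrib right_diff_distrib)
  show ?thesis
    using com_mult_right[OF A p] by (simp add: com_trivial)
qed

section \<open>The objects of the theorem as families over the parameter\<close>

lemma sum_1_4: "(\<Sum>k=1..4. f k) = (\<Sum>k\<in>idx. f k)"
  by (simp only: idx_def)

lemma tn_A_A_p:
  assumes "i \<in> idx" "k \<in> idx" "j \<in> idx" "l \<in> idx"
  shows "tn (\<lambda>_. Amat i k * sl_adj (Amat j l)) \<omega> = Aq i k * As j l * fq \<omega>"
  using assms tn_split[of "\<lambda>_. Amat i k * sl_adj (Amat j l)" \<omega>] by (simp add: Aq_def As_def tn_mult)

lemma abs_fam_sum: "abs_fam (\<lambda>\<theta>. \<Sum>i\<in>I. f i \<theta>) = (\<Sum>i\<in>I. abs_fam (f i))"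
proof (induction I rule: infinite_finite_induct)
  case (insert i I)
  have "abs_fam (f i) + abs_fam (\<lambda>\<theta>. \<Sum>i\<in>I. f i \<theta>) = abs_fam (\<lambda>\<theta>. f i \<theta> + (\<Sum>i\<in>I. f i \<theta>))"
    by (rule plus_fam.abs_eq)
  with insert show ?case by simp
qed (simp_all flip: zero_fam_def)

lemmas fam_abs = sc.abs_eq tn.abs_eq dq.abs_eq times_fam.abs_eq abs_fam_sum [symmetric]

lemma rho_eq: "rho = rr 0"
proof -
  have "rho = half * (\<Sum>i\<in>idx. \<Sum>k\<in>idx. \<Sum>l\<in>idx. sc (\<lambda>\<theta>. eta \<theta> l k) *
     tn (\<lambda>_. sl_adj (Amat i l) * Amat i k) (\<lambda>\<theta>. pmat \<theta> k l))"
    unfolding half_def fam_abs rho_def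
    by (intro arg_cong[where f=abs_fam] ext) (simp add: rho2_def rho2_with_def csc_mult_left sum_1_4)
  also have "\<dots> = half * (\<Sum>i\<in>idx. \<Sum>k\<in>idx. \<Sum>l\<in>idx. ph (wd k l) * (As i l * Aq i k * pq 0 k l))"
  proof (intro arg_cong[where f="(*) half"] sum.cong refl)
    fix i k l assume ix: "i \<in> idx" "k \<in> idx" "l \<in> idx"
    have "sc (\<lambda>\<theta>. eta \<theta> l k) = ph (wd k l)"
      using ix eta_eq[of l k] wd_swap[of l k] by (simp add: ph_def idx_def)
    moreover have "tn (\<lambda>_. sl_adj (Amat i l) * Amat i k) (\<lambda>\<theta>. pmat \<theta> k l) = As i l * Aq i k * pq 0 k l"
      using ix tn_split[of "\<lambda>_. sl_adj (Amat i l) * Amat i k" "\<lambda>\<theta>. pmat \<theta> k l"]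
      by (simp add: Aq_def As_def pq_def tn_mult)
    ultimately show "sc (\<lambda>\<theta>. eta \<theta> l k) * tn (\<lambda>_. sl_adj (Amat i l) * Amat i k) (\<lambda>\<theta>. pmat \<theta> k l)
        = ph (wd k l) * (As i l * Aq i k * pq 0 k l)"
      by (simp only:)
  qed
  also have "(\<Sum>i\<in>idx. \<Sum>k\<in>idx. \<Sum>l\<in>idx. ph (wd k l) * (As i l * Aq i k * pq 0 k l))
     = (\<Sum>k\<in>idx. \<Sum>l\<in>idx. \<Sum>i\<in>idx. ph (wd k l) * (As i l * Aq i k * pq 0 k l))"
    by (subst sum.swap, rule sum.cong[OF refl], rule sum.swap)
  also have "half * \<dots> = rr 0"
    by (simp only: rr_def H_def sum_distrib_left sum_distrib_right)
  finally show ?thesis .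
qed

lemma dq_Aq [simp]: "dq (Aq i k) = 0" "dq (As i k) = 0" and gq_Aq [simp]: "gq (Aq i k) = Aq i k" "gq (As i k) = As i k"
  by (simp_all add: Aq_def As_def dq_tn gq_tn)

lemma dq_pq: "dq (pq 0 k l) = pq (Suc 0) k l" and gq_pq: "gq (pq 0 k l) = pq 0 k l"
  by (auto simp: pq_def fq_def dq_tn gq_tn fgrade_pmat idx_def)

lemma gq_ph [simp]: "gq (ph n) = ph n" "dq (ph n) = 0" and gq_half [simp]: "gq half = half" "dq half = 0"
  by (simp_all add: ph_def half_def)

lemma dq_H [simp]: "dq (H l k) = 0" and gq_H [simp]: "gq (H l k) = H l k"
  by (simp_all add: H_def dq_sum gq_sum dq_mult gq_mult)

lemma dq_rho: "dq rho = rr (Suc 0)"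
  by (simp add: rho_eq rr_def dq_mult dq_sum gq_mult gq_sum dq_pq)

lift_definition Pq :: "nat \<Rightarrow> nat \<Rightarrow> fam" is "\<lambda>i j \<theta>. Pmat \<theta> i j" .
lift_definition curvq :: "nat \<Rightarrow> nat \<Rightarrow> fam" is "\<lambda>i j \<theta>. curv \<theta> i j" .
text \<open>The family with value \<open>u\<close> at the parameter \<open>\<theta>'\<close> and \<open>0\<close> at all others.\<close>

lift_definition at_param :: "real \<Rightarrow> eelem \<Rightarrow> fam" is "\<lambda>\<theta>' u \<theta>. if \<theta> = \<theta>' then u else 0" .

lemma at_param_eq_iff: "at_param \<theta> u = at_param \<theta> v \<longleftrightarrow> E_eq \<theta> u v"
  by transfer auto

lemma at_param_add: "at_param \<theta> (u + v) = at_param \<theta> u + at_param \<theta> v"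
  and at_param_zero: "at_param \<theta> 0 = 0" and dq_at_param: "dq (at_param \<theta> u) = at_param \<theta> (dE \<theta> u)"
  and Pq_at_param: "Pq i j * at_param \<theta> u = at_param \<theta> (Pmat \<theta> i j * u)"
  and curvq_at_param: "curvq i j * at_param \<theta> u = at_param \<theta> (curv \<theta> i j * u)"
  by (transfer; simp)+

lemma at_param_sum: "at_param \<theta> (sum f I) = (\<Sum>i\<in>I. at_param \<theta> (f i))"
  by (induction I rule: infinite_finite_induct) (simp_all add: at_param_add at_param_zero)

lemma curvq_eq: "curvq i l = (\<Sum>j\<in>idx. \<Sum>k\<in>idx. Pq i j * dq (Pq j k) * dq (Pq k l))"
  unfolding Pq.abs_eq curvq.abs_eq fam_abs
  by (intro arg_cong[where f=abs_fam] ext) (simp add: curv_def sum_1_4)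

lemma Pq_eq:
  assumes "i \<in> idx" "j \<in> idx"
  shows "Pq i j = rinv * (\<Sum>l\<in>idx. (\<Sum>k\<in>idx. Aq i k * pq 0 k l) * As j l)"
proof -
  have "Pq i j = rinv * (\<Sum>k\<in>idx. \<Sum>l\<in>idx. tn (\<lambda>_. Amat i k * sl_adj (Amat j l)) (\<lambda>\<theta>. pmat \<theta> k l))"
    unfolding Pq.abs_eq fam_abs rinv_def
    by (intro arg_cong[where f=abs_fam] ext) (simp add: Pmat_def sum_1_4)
  also have "(\<Sum>k\<in>idx. \<Sum>l\<in>idx. tn (\<lambda>_. Amat i k * sl_adj (Amat j l)) (\<lambda>\<theta>. pmat \<theta> k l))
    = (\<Sum>k\<in>idx. \<Sum>l\<in>idx. Aq i k * pq 0 k l * As j l)"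
  proof (intro sum.cong refl)
    fix k l assume "k \<in> idx" "l \<in> idx"
    then show "tn (\<lambda>_. Amat i k * sl_adj (Amat j l)) (\<lambda>\<theta>. pmat \<theta> k l) = Aq i k * pq 0 k l * As j l"
      using assms com_As_p[of j l 0 k l] by (simp add: tn_A_A_p pq_def com_trivial mult.assoc)
  qed
  also have "\<dots> = (\<Sum>l\<in>idx. (\<Sum>k\<in>idx. Aq i k * pq 0 k l) * As j l)"
    by (subst sum.swap) (simp only: sum_distrib_right)
  finally show ?thesis .
qed

lifting_forget fam.lifting

section \<open>Four by four matrices\<close>

text \<open>Matrices form a type so that the curvature calculation can use ring laws for whole
  matrices. Vanishing outside the index range makes equality of matrices equality of
  functions.\<close>

typedef mat4 = "{M :: nat \<Rightarrow> nat \<Rightarrow> fam. \<forall>i j. i \<notin> idx \<or> j \<notin> idx \<longrightarrow> M i j = 0}"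
  morphisms ent Abs_mat4
  by (rule exI[of _ "\<lambda>_ _. 0"]) simp

setup_lifting type_definition_mat4

instantiation mat4 :: "{ring, monoid_mult}"
begin

lift_definition zero_mat4 :: mat4 is "\<lambda>_ _. 0" by simp
lift_definition one_mat4 :: mat4 is "\<lambda>i j. if i = j \<and> i \<in> idx then 1 else 0" by auto
lift_definition plus_mat4 :: "mat4 \<Rightarrow> mat4 \<Rightarrow> mat4" is "\<lambda>M N i j. M i j + N i j" by simp
lift_definition minus_mat4 :: "mat4 \<Rightarrow> mat4 \<Rightarrow> mat4" is "\<lambda>M N i j. M i j - N i j" by simp
lift_definition uminus_mat4 :: "mat4 \<Rightarrow> mat4" is "\<lambda>M i j. - M i j" by simp
lift_definition times_mat4 :: "mat4 \<Rightarrow> mat4 \<Rightarrow> mat4" is "\<lambda>M N i j. \<Sum>k\<in>idx. M i k * N k j"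
  by (auto intro!: sum.neutral)

instance
proof
  fix a b c :: mat4
  show "a * b * c = a * (b * c)"
  proof (transfer, intro ext)
    fix a b c :: "nat \<Rightarrow> nat \<Rightarrow> fam" and i j
    have "(\<Sum>k\<in>idx. \<Sum>l\<in>idx. a i l * b l k * c k j) = (\<Sum>l\<in>idx. \<Sum>k\<in>idx. a i l * b l k * c k j)"
      by (rule sum.swap)
    then show "(\<Sum>k\<in>idx. (\<Sum>l\<in>idx. a i l * b l k) * c k j) = (\<Sum>l\<in>idx. a i l * (\<Sum>k\<in>idx. b l k * c k j))"
      by (simp only: sum_distrib_left sum_distrib_right mult.assoc)
  qed
  have fin: "finite idx"
    by (simp add: idx_def)
  show "1 * a = a"
  proof (transfer, intro ext)
    fix a :: "nat \<Rightarrow> nat \<Rightarrow> fam" and i j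
    assume *: "\<forall>i j. i \<notin> idx \<or> j \<notin> idx \<longrightarrow> a i j = 0"
    have "(\<Sum>k\<in>idx. (if i = k \<and> i \<in> idx then 1 else 0) * a k j) = (\<Sum>k\<in>idx. if k = i then a k j else 0)"
      by (intro sum.cong) auto
    with fin * show "(\<Sum>k\<in>idx. (if i = k \<and> i \<in> idx then 1 else 0) * a k j) = a i j"
      by (simp add: sum.delta)
  qed
  show "a * 1 = a"
  proof (transfer, intro ext)
    fix a :: "nat \<Rightarrow> nat \<Rightarrow> fam" and i j
    assume *: "\<forall>i j. i \<notin> idx \<or> j \<notin> idx \<longrightarrow> a i j = 0"
    have "(\<Sum>k\<in>idx. a i k * (if k = j \<and> k \<in> idx then 1 else 0)) = (\<Sum>k\<in>idx. if k = j then a i k else 0)"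
      by (intro sum.cong) auto
    with fin * show "(\<Sum>k\<in>idx. a i k * (if k = j \<and> k \<in> idx then 1 else 0)) = a i j"
      by (simp add: sum.delta)
  qed
qed (transfer, intro ext, simp add: algebra_simps sum.distrib)+

end

lift_definition mk :: "(nat \<Rightarrow> nat \<Rightarrow> fam) \<Rightarrow> mat4" is "\<lambda>f i j. if i \<in> idx \<and> j \<in> idx then f i j else 0"
  by auto

lift_definition dm :: "mat4 \<Rightarrow> mat4" is "\<lambda>M i j. dq (M i j)" by simp
lift_definition gm :: "mat4 \<Rightarrow> mat4" is "\<lambda>M i j. gq (M i j)" by simp

definition dg :: "fam \<Rightarrow> mat4" where
  "dg x = mk (\<lambda>i j. if i = j then x else 0)"

lemma ent_simps [simp]:
  "ent (M + N) i j = ent M i j + ent N i j" "ent (M - N) i j = ent M i j - ent N i j"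
  "ent (- M) i j = - ent M i j" "ent 0 i j = 0"
  "ent (dm M) i j = dq (ent M i j)" "ent (gm M) i j = gq (ent M i j)"
  "i \<in> idx \<Longrightarrow> j \<in> idx \<Longrightarrow> ent (mk f) i j = f i j"
  by (transfer; simp)+

lemma ent_mult: "ent (M * N) i j = (\<Sum>k\<in>idx. ent M i k * ent N k j)"
  by transfer simp

lemma ent_one: "i \<in> idx \<Longrightarrow> ent 1 i j = (if i = j then 1 else 0)"
  by transfer simp

lemma mat4_eqI: "(\<And>i j. i \<in> idx \<Longrightarrow> j \<in> idx \<Longrightarrow> ent M i j = ent N i j) \<Longrightarrow> M = N"
  by (transfer, intro ext) metis

lemma finite_idx [simp]: "finite idx"
  by (simp add: idx_def)

lemma ent_diag_mult:
  assumes "i \<in> idx" "j \<in> idx"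
  shows "ent (mk (\<lambda>i j. if i = j then f i else 0) * M) i j = f i * ent M i j"
    and "ent (M * mk (\<lambda>i j. if i = j then f i else 0)) i j = ent M i j * f j"
proof -
  have "ent (mk (\<lambda>i j. if i = j then f i else 0) * M) i j = (\<Sum>k\<in>idx. if k = i then f i * ent M k j else 0)"
    unfolding ent_mult using assms by (intro sum.cong) auto
  then show "ent (mk (\<lambda>i j. if i = j then f i else 0) * M) i j = f i * ent M i j"
    using assms by (simp add: sum.delta)
  have "ent (M * mk (\<lambda>i j. if i = j then f i else 0)) i j = (\<Sum>k\<in>idx. if k = j then ent M i k * f j else 0)"
    unfolding ent_mult using assms by (intro sum.cong) auto
  then show "ent (M * mk (\<lambda>i j. if i = j then f i else 0)) i j = ent M i j * f j"
    using assms by (simp add: sum.delta)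
qed

lemma ent_dg_mult:
  assumes "i \<in> idx" "j \<in> idx"
  shows "ent (dg x * M) i j = x * ent M i j" "ent (M * dg x) i j = ent M i j * x"
  unfolding dg_def by (rule ent_diag_mult[OF assms])+

lemma dg_mult: "dg x * dg y = dg (x * y)"
  by (rule mat4_eqI) (simp add: ent_dg_mult, simp add: dg_def)

lemma dg_simps [simp]: "dg 1 = 1" "dg 0 = 0" "dg (- x) = - dg x" "dm (dg x) = dg (dq x)" "gm (dg x) = dg (gq x)"
  by (rule mat4_eqI; simp add: dg_def ent_one)+

lemma dm_mult: "dm (M * N) = dm M * N + gm M * dm N"
  by (rule mat4_eqI) (simp add: ent_mult dq_sum dq_mult sum.distrib)

lemma gm_mult: "gm (M * N) = gm M * gm N"
  by (rule mat4_eqI) (simp add: ent_mult gq_sum gq_mult)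

lemma dm_dm [simp]: "dm (dm M) = 0"
  by (rule mat4_eqI) simp

text \<open>To be read with t inverse to R, r = dR and q = dQ, so that
  \<open>t * q - t * r * t * Q\<close> is d(t Q). Of the four terms of the expansion, the two ending
  in Q acquire a factor \<open>r * r\<close>, one of them through \<open>QqQ\<close>, and vanish; in
  the term with r that remains, \<open>QQ\<close> supplies an R that absorbs one t.\<close>

lemma curvature_rescale:
  fixes t R r Q q :: "'a :: {ring, monoid_mult}"
  assumes tR: "t * R = 1" "R * t = 1" and QQ: "Q * Q = R * Q"
    and comm: "Q * R = R * Q" "q * R = R * q" "r * R = R * r" "Q * r = r * Q" "q * r = - (r * q)"
    and rr: "r * r = 0" and QqQ: "Q * q * Q = r * R * Q"
  shows "(t * Q) * (t * q - t * r * t * Q) * (t * q - t * r * t * Q) = t * t * t * (Q * q * q - r * Q * q)"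
proof -
  have t: "x * t = t * x" if "x * R = R * x" for x
    by (metis mult.assoc mult_1_left mult_1_right tR that)
  note tc = t[OF comm(1)] t[OF comm(2)] t[OF comm(3)]
  have left: "x * (y * z) = w * z" if "x * y = w" for x y z w :: 'a
    using that by (simp add: mult.assoc [symmetric])
  note L = left[OF tc(1)] left[OF tc(2)] left[OF tc(3)] left[OF comm(1)] left[OF comm(2)] left[OF comm(3)]
    left[OF comm(4)] left[OF comm(5)] left[OF QQ] left[OF rr] left[OF tR(1)] left[OF tR(2)]
  have Q3: "Q * (q * Q) = r * (R * Q)" "Q * (q * (Q * z)) = r * (R * (Q * z))" for z
    using QqQ by (simp_all add: mult.assoc) (metis mult.assoc)
  show ?thesis
    by (simp add: algebra_simps tc L comm QQ rr tR Q3)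
qed

section \<open>The curvature\<close>

definition mA :: mat4 where "mA = mk Aq"
definition mA' :: mat4 where "mA' = mk (\<lambda>l j. As j l)"
definition mp :: "nat \<Rightarrow> mat4" where "mp b = mk (pq b)"
definition mH :: mat4 where "mH = mk H"
definition mD :: mat4 where "mD = mk (\<lambda>i j. if i = j then Dd i else 0)"
definition mQ :: "nat \<Rightarrow> mat4" where "mQ b = mA * mp b * mA'"
definition mP :: mat4 where "mP = mk Pq"

lemma mH_eq: "mH = mA' * mA"
  by (rule mat4_eqI) (simp add: mH_def mA_def mA'_def ent_mult H_def cong: sum.cong_simp)

lemma d_mats [simp]: "dm mA = 0" "dm mA' = 0" "gm mA = mA" "gm mA' = mA'"
  "dm mH = 0" "gm mH = mH" "dm (mp 0) = mp 1" "gm (mp 0) = mp 0"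
  by (rule mat4_eqI; simp add: mA_def mA'_def mH_def mp_def dq_pq gq_pq flip: One_nat_def)+

lemma mp_mH_mp: "mp 0 * mH * mp 0 = mp 0 * mD"
  unfolding mD_def
  by (rule mat4_eqI, subst ent_diag_mult)
    (simp_all add: mp_def mH_def ent_mult p_H_p cong: sum.cong_simp)

lemma mp_mp: "mp 0 * mp 0 = mp 0"
  by (rule mat4_eqI) (simp add: mp_def ent_mult p_p cong: sum.cong_simp)

lemma mH_mp_mH: "mH * mp 0 * mH = mD * mH - dg xi * (1 - mp 0)"
  unfolding mD_def
  by (rule mat4_eqI)
    (simp add: ent_diag_mult ent_dg_mult ent_one, simp add: mp_def mH_def ent_mult H_p_H cong: sum.cong_simp)

lemma mQ_ent: "i \<in> idx \<Longrightarrow> j \<in> idx \<Longrightarrow> ent (mQ b) i j = (\<Sum>l\<in>idx. (\<Sum>k\<in>idx. Aq i k * pq b k l) * As j l)"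
  by (simp add: mQ_def mA_def mp_def mA'_def ent_mult cong: sum.cong_simp)

lemma mA_mp_ent: "i \<in> idx \<Longrightarrow> j \<in> idx \<Longrightarrow> ent (mA * mp b) i j = (\<Sum>k\<in>idx. Aq i k * pq b k j)"
  by (simp add: mA_def mp_def ent_mult cong: sum.cong_simp)

lemma mP_eq: "mP = dg rinv * mQ 0"
  by (rule mat4_eqI) (simp add: ent_dg_mult mQ_ent, simp add: mP_def Pq_eq)

text \<open>The same diagonal matrix serves p and dp, because they have the same weights.\<close>

lemma rho_mA_mp: "b \<le> 1 \<Longrightarrow> dg rho * (mA * mp b) = mA * mp b * mD"
  unfolding mD_def
  by (rule mat4_eqI)
    (simp add: ent_diag_mult ent_dg_mult mA_mp_ent rho_eq sum_distrib_left sum_distrib_right rr_mult_Ap)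

lemma xi_mA_mp: "dg xi * (mA * mp b) = mA * mp b * dg xi"
  by (rule mat4_eqI) (simp add: ent_dg_mult mA_mp_ent sum_distrib_left sum_distrib_right xi_commute)

lemma rho_comm:
  "mQ 0 * dg rho = dg rho * mQ 0" "mQ 1 * dg rho = dg rho * mQ 1" "dg (dq rho) * dg rho = dg rho * dg (dq rho)"
  "mQ 0 * dg (dq rho) = dg (dq rho) * mQ 0" "mQ 1 * dg (dq rho) = - (dg (dq rho) * mQ 1)"
  "dg (dq rho) * dg (dq rho) = 0"
proof -
  note c = com_rr_Q[of 0 0] com_rr_Q[of 0 1] com_rr_Q[of 1 0]
  note o = com_rr_Q[of 1 1, unfolded com_def, simplified, unfolded sg_def, simplified]
  show "mQ 0 * dg rho = dg rho * mQ 0" "mQ 1 * dg rho = dg rho * mQ 1" "mQ 0 * dg (dq rho) = dg (dq rho) * mQ 0"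
    by (rule mat4_eqI; simp add: ent_dg_mult mQ_ent rho_eq dq_rho[unfolded rho_eq] c[simplified, unfolded com_trivial] flip: One_nat_def)+
  show "mQ 1 * dg (dq rho) = - (dg (dq rho) * mQ 1)"
    by (rule mat4_eqI) (simp add: ent_dg_mult mQ_ent dq_rho o flip: One_nat_def)
  have "rr 1 * rr 0 = rr 0 * rr 1"
    using com_rr_rr[of 1 0] by (simp add: com_trivial)
  then show "dg (dq rho) * dg rho = dg rho * dg (dq rho)"
    by (simp add: dg_mult dq_rho rho_eq dq_rho[unfolded rho_eq] flip: One_nat_def)
  \<comment> \<open>An odd element that anticommutes with itself has square zero, as 2 is
    invertible.\<close>
  have "rr 1 * rr 1 = - (rr 1 * rr 1)"
    using com_rr_rr[of 1 1] by (simp add: com_def sg_def)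
  then have "rr 1 * rr 1 = 0"
    by (metis half_cancel neg_eq_iff_add_eq_0)
  then show "dg (dq rho) * dg (dq rho) = 0"
    by (simp add: dg_mult dq_rho flip: One_nat_def)
qed

lemma dg_rho_inv: "dg rinv * dg rho = 1" "dg rho * dg rinv = 1"
  by (simp_all add: dg_mult)

lemma dm_mQ: "dm (mQ 0) = mQ 1" "gm (mQ 0) = mQ 0"
  by (simp_all add: mQ_def dm_mult gm_mult)

text \<open>Compressing H by p gives the diagonal matrix \<open>mD\<close>, not \<rho>^2; the factor
  A on the left is what turns it back into \<rho>^2.\<close>

lemma mA_mp_mH_mp: "mA * mp 0 * mH * mp 0 = dg rho * (mA * mp 0)"
proof -
  have "mA * mp 0 * mH * mp 0 = mA * (mp 0 * mH * mp 0)"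
    by (simp only: mult.assoc)
  also have "\<dots> = mA * mp 0 * mD"
    unfolding mp_mH_mp by (simp only: mult.assoc)
  also have "\<dots> = dg rho * (mA * mp 0)"
    by (simp add: rho_mA_mp)
  finally show ?thesis .
qed

lemma mQ_mQ: "mQ 0 * mQ 0 = dg rho * mQ 0"
proof -
  have "mQ 0 * mQ 0 = (mA * mp 0 * mH * mp 0) * mA'"
    by (simp add: mQ_def mH_eq mult.assoc)
  also have "\<dots> = dg rho * (mA * mp 0) * mA'"
    by (simp only: mA_mp_mH_mp)
  also have "\<dots> = dg rho * mQ 0"
    by (simp only: mQ_def mult.assoc)
  finally show ?thesis .
qed

text \<open>Differentiate Q Q = r Q and multiply by Q from the left: the terms r Q dQ on both sides
  cancel.\<close>

lemma mQ_mQ_mQ: "mQ 0 * mQ 1 * mQ 0 = dg (dq rho) * dg rho * mQ 0"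
proof -
  have "mQ 1 * mQ 0 + mQ 0 * mQ 1 = dg (dq rho) * mQ 0 + dg rho * mQ 1"
    using arg_cong[OF mQ_mQ, of dm] by (simp add: dm_mult dm_mQ)
  then have "mQ 0 * (mQ 1 * mQ 0 + mQ 0 * mQ 1) = mQ 0 * (dg (dq rho) * mQ 0 + dg rho * mQ 1)"
    by (rule arg_cong)
  then have "mQ 0 * mQ 1 * mQ 0 + dg rho * mQ 0 * mQ 1 = mQ 0 * dg (dq rho) * mQ 0 + dg rho * mQ 0 * mQ 1"
    by (simp only: distrib_left mult.assoc [symmetric] mQ_mQ rho_comm(1))
  then have "mQ 0 * mQ 1 * mQ 0 = mQ 0 * dg (dq rho) * mQ 0"
    by (simp only: add_right_cancel)
  also have "\<dots> = dg (dq rho) * (dg rho * mQ 0)"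
    by (simp only: rho_comm(4) mult.assoc mQ_mQ)
  finally show ?thesis
    by (simp only: mult.assoc)
qed

lemma mP_mP: "mP * mP = mP"
proof -
  have "mQ 0 * dg rinv = dg rinv * (dg rho * mQ 0) * dg rinv"
    by (simp add: dg_rho_inv flip: mult.assoc)
  also have "\<dots> = dg rinv * mQ 0 * (dg rho * dg rinv)"
    by (simp only: mult.assoc flip: rho_comm(1))
  finally have comm: "mQ 0 * dg rinv = dg rinv * mQ 0"
    by (simp add: dg_rho_inv)
  have "mP * mP = dg rinv * (mQ 0 * dg rinv) * mQ 0"
    by (simp only: mP_eq mult.assoc)
  also have "\<dots> = dg rinv * (dg rinv * (mQ 0 * mQ 0))"
    by (simp only: comm mult.assoc)
  also have "\<dots> = dg rinv * (dg rinv * dg rho * mQ 0)"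
    by (simp only: mQ_mQ mult.assoc)
  finally show ?thesis
    by (simp add: dg_rho_inv mP_eq)
qed

lemma mQ_mQ_mQ_curv: "mQ 0 * mQ 1 * mQ 1 - dg (dq rho) * mQ 0 * mQ 1 = dg xi * mA * mp 0 * mp 1 * mp 1 * mA'"
proof -
  let ?r = "dg (dq rho)" and ?R = "dg rho" and ?p = "mp 0" and ?e = "mp 1"
  have e: "?e * ?p + ?p * ?e = ?e"
    using arg_cong[OF mp_mp, of dm] by (simp add: dm_mult)
  \<comment> \<open>From e p + p e = e: the complementary projection between two factors e becomes p
    in front, which is where the basic curvature p e e appears.\<close>
  have eepe: "?e * ?e - ?e * ?p * ?e = ?p * ?e * ?e"
    using arg_cong[OF e, of "\<lambda>x. x * ?e"] by (simp add: distrib_right algebra_simps)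
  have "mA * ?e * mH * ?p + mA * ?p * mH * ?e = ?r * (mA * ?p) + ?R * (mA * ?e)"
    using arg_cong[OF mA_mp_mH_mp, of dm] by (simp add: dm_mult gm_mult)
  \<comment> \<open>Writing r A e as A e D places \<open>mD\<close> so that multiplication by H e
    from the right produces D H - H p H, the combination evaluated by
    \<open>mH_mp_mH\<close>.\<close>
  then have *: "mA * ?p * mH * ?e = ?r * (mA * ?p) + mA * ?e * mD - mA * ?e * mH * ?p"
    by (simp add: rho_mA_mp algebra_simps)
  have "mA * ?p * mH * ?e * mH * ?e
      = ?r * (mA * ?p) * mH * ?e + mA * ?e * (mD * mH - mH * ?p * mH) * ?e"
    unfolding * by (simp add: algebra_simps)
  also have "mD * mH - mH * ?p * mH = dg xi * (1 - ?p)"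
    by (simp add: mH_mp_mH)
  also have "mA * ?e * (dg xi * (1 - ?p)) * ?e = dg xi * (mA * ?e) * (1 - ?p) * ?e"
    by (simp only: xi_mA_mp mult.assoc)
  also have "\<dots> = dg xi * mA * (?e * ?e - ?e * ?p * ?e)"
    by (simp add: algebra_simps)
  also have "\<dots> = dg xi * mA * (?p * ?e * ?e)"
    by (simp only: eepe)
  finally have "(mA * ?p * mH * ?e * mH * ?e) * mA' - (?r * (mA * ?p) * mH * ?e) * mA' = dg xi * mA * (?p * ?e * ?e) * mA'"
    by (simp add: distrib_right)
  then show ?thesis
    by (simp add: mQ_def mH_eq mult.assoc)
qed

lemma mP_curvature: "mP * dm mP * dm mP = dg rinv * dg rinv * dg rinv * (dg xi * mA * mp 0 * mp 1 * mp 1 * mA')"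
proof -
  have "dm mP = dg rinv * mQ 1 - dg rinv * dg (dq rho) * dg rinv * mQ 0"
    by (simp add: mP_eq dm_mult dm_mQ dq_rinv dg_mult)
  then show ?thesis
    using curvature_rescale[OF dg_rho_inv mQ_mQ rho_comm(1,2,3,4,5,6) mQ_mQ_mQ]
    by (simp only: mP_eq mQ_mQ_mQ_curv)
qed

lemma curvq_ent: "i \<in> idx \<Longrightarrow> l \<in> idx \<Longrightarrow> curvq i l = ent (mP * dm mP * dm mP) i l"
proof -
  assume il: "i \<in> idx" "l \<in> idx"
  have "ent (mP * dm mP * dm mP) i l = (\<Sum>k\<in>idx. \<Sum>j\<in>idx. Pq i j * dq (Pq j k) * dq (Pq k l))"
    using il by (simp add: mP_def ent_mult sum_distrib_right cong: sum.cong_simp)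
  also have "\<dots> = curvq i l"
    unfolding curvq_eq by (rule sum.swap)
  finally show ?thesis ..
qed

lemma nabla_nabla:
  assumes "P_section \<theta> \<psi>" "i \<in> {1..4}"
  shows "E_eq \<theta> (nabla \<theta> (nabla \<theta> \<psi>) i) (\<Sum>l=1..4. curv \<theta> i l * \<psi> l)"
proof -
  have i: "i \<in> idx"
    using assms by (simp add: idx_def)
  \<comment> \<open>A section is stored as the first column of a matrix and placed at the single
    parameter \<theta>, so that \<open>dm_mult\<close> also yields the Leibniz rule for P
    \<psi>.\<close>
  define V where "V f = mk (\<lambda>i j. if j = 1 then at_param \<theta> (f i) else 0)" for f :: "nat \<Rightarrow> eelem"
  have mult_V: "ent (mk M * V f) i 1 = (\<Sum>j\<in>idx. M i j * at_param \<theta> (f j))" if "i \<in> idx" for M f i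
    using that by (simp add: V_def ent_mult cong: sum.cong_simp)
  have V_eqI: "mk M * V f = V h" if "\<And>i. i \<in> idx \<Longrightarrow> (\<Sum>j\<in>idx. M i j * at_param \<theta> (f j)) = at_param \<theta> (h i)" for M f h
    using that by (intro mat4_eqI) (simp add: V_def ent_mult cong: sum.cong_simp)
  have dV: "dm (V f) = V (\<lambda>i. dE \<theta> (f i))" for f
    by (rule mat4_eqI) (simp add: V_def dq_at_param)
  have "(\<Sum>j\<in>idx. Pq k j * at_param \<theta> (\<psi> j)) = at_param \<theta> (\<psi> k)" if "k \<in> idx" for k
  proof -
    have "E_eq \<theta> (\<Sum>j=1..4. Pmat \<theta> k j * \<psi> j) (\<psi> k)"
      using assms(1) that unfolding P_section_def idx_def by blast
    then have "at_param \<theta> (\<Sum>j\<in>idx. Pmat \<theta> k j * \<psi> j) = at_param \<theta> (\<psi> k)"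
      unfolding at_param_eq_iff by (simp only: idx_def)
    then show ?thesis
      by (simp only: at_param_sum Pq_at_param)
  qed
  then have PV: "mP * V \<psi> = V \<psi>"
    unfolding mP_def by (rule V_eqI)
  have nab: "mP * dm (V f) = V (nabla \<theta> f)" for f
    unfolding mP_def dV
    by (rule V_eqI) (simp only: nabla_def sum_1_4 at_param_sum Pq_at_param)
  have "dm mP * mP + mP * dm mP = dm mP"
    using arg_cong[OF mP_mP, of dm] by (simp add: dm_mult mP_eq gm_mult dm_mQ)
  then have "mP * (dm mP * mP + mP * dm mP) = mP * dm mP"
    by simp
  \<comment> \<open>The off-diagonality of the differential of a projection; it removes the
    first-order term in the derivative of \<psi>.\<close>
  then have PdPP: "mP * dm mP * mP = 0"
    by (simp add: distrib_left mP_mP flip: mult.assoc)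
  have gP: "gm mP = mP"
    by (simp add: mP_eq gm_mult dm_mQ)
  have dP: "dm (V \<psi>) = dm mP * V \<psi> + mP * dm (V \<psi>)"
    using arg_cong[OF PV, of dm] by (simp add: dm_mult gP)
  have "V (nabla \<theta> (nabla \<theta> \<psi>)) = mP * dm (mP * dm (V \<psi>))"
    by (simp only: nab)
  also have "\<dots> = mP * dm mP * dm (V \<psi>)"
    by (simp add: dm_mult mult.assoc)
  also have "\<dots> = mP * dm mP * (dm mP * V \<psi> + mP * dm (V \<psi>))"
    by (subst dP) simp
  also have "\<dots> = mP * dm mP * dm mP * V \<psi>"
    by (simp add: distrib_left PdPP flip: mult.assoc)
  also have "mP * dm mP * dm mP = mk curvq"
    by (rule mat4_eqI) (simp add: curvq_ent)
  finally have "ent (V (nabla \<theta> (nabla \<theta> \<psi>))) i 1 = ent (mk curvq * V \<psi>) i 1"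
    by (rule arg_cong)
  then have "at_param \<theta> (nabla \<theta> (nabla \<theta> \<psi>) i) = (\<Sum>l\<in>idx. curvq i l * at_param \<theta> (\<psi> l))"
    using i by (simp only: mult_V) (simp add: V_def)
  then have "at_param \<theta> (nabla \<theta> (nabla \<theta> \<psi>) i) = at_param \<theta> (\<Sum>l\<in>idx. curv \<theta> i l * \<psi> l)"
    by (simp only: curvq_at_param at_param_sum)
  then show ?thesis
    by (simp only: at_param_eq_iff idx_def)
qed

section \<open>The curvature as an explicit sum of tensors\<close>

definition H_sl :: "nat \<Rightarrow> nat \<Rightarrow> sl_free" where
  "H_sl l k = (\<Sum>i\<in>idx. sl_adj (Amat i l) * Amat i k)"

text \<open>A representative of \<open>xi\<close> in the free algebra, needed because
  \<open>hodge_E\<close> asks for explicit first tensor factors.\<close>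

definition xi_sl :: sl_free where
  "xi_sl = H_sl 1 1 * H_sl 3 3 - H_sl 1 3 * H_sl 3 1 - H_sl 1 4 * H_sl 4 1"

lemma H_tn: "l \<in> idx \<Longrightarrow> k \<in> idx \<Longrightarrow> H l k = tn (\<lambda>_. H_sl l k) (\<lambda>_. fone)"
  unfolding H_def H_sl_def sum_idx by (simp add: As_def Aq_def tn_mult tn_add_left)

lemma xi_tn: "xi = tn (\<lambda>_. xi_sl) (\<lambda>_. fone)"
  unfolding xi_def xi_sl_def by (simp add: H_tn tn_mult tn_diff_left)

lemma fq_sum: "fq (\<lambda>\<theta>. \<Sum>i\<in>I. \<omega> i \<theta>) = (\<Sum>i\<in>I. fq (\<omega> i))"
  unfolding fq_def by (rule tn_sum_right)

lemma basic_curv_fq: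
  assumes "i \<in> idx" "l \<in> idx"
  shows "fq (\<lambda>\<theta>. basic_curv \<theta> i l) = ent (mp 0 * mp 1 * mp 1) i l"
proof -
  have "ent (mp 0 * mp 1 * mp 1) i l = (\<Sum>k\<in>idx. \<Sum>j\<in>idx. pq 0 i j * pq 1 j k * pq 1 k l)"
    using assms by (simp add: mp_def ent_mult sum_distrib_right cong: sum.cong_simp)
  also have "\<dots> = (\<Sum>j\<in>idx. \<Sum>k\<in>idx. pq 0 i j * pq 1 j k * pq 1 k l)"
    by (rule sum.swap)
  also have "\<dots> = fq (\<lambda>\<theta>. basic_curv \<theta> i l)"
    unfolding basic_curv_def sum_1_4 fq_sum using assms by (simp add: pq_def fq_mult cong: sum.cong_simp)
  finally show ?thesis ..
qed

text \<open>The factor \<open>xi\<close> is absorbed into the first tensor factor, leaving a power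
  of \<open>rinv\<close> times a sum of pure tensors, the shape on which \<open>hodge_E\<close> is
  defined.\<close>

lemma curvq_tn:
  assumes "i \<in> idx" "j \<in> idx"
  shows "curvq i j = rinv * rinv * rinv * (\<Sum>k\<in>idx. \<Sum>l\<in>idx.
     tn (\<lambda>_. xi_sl * Amat i k * sl_adj (Amat j l)) (\<lambda>\<theta>. basic_curv \<theta> k l))"
proof -
  have ent: "ent (mA * M * mA') i j = (\<Sum>l\<in>idx. \<Sum>k\<in>idx. Aq i k * ent M k l * As j l)" for M
    unfolding ent_mult sum_distrib_right using assms by (simp add: mA_def mA'_def cong: sum.cong_simp)
  have "mP * dm mP * dm mP = dg (rinv * rinv * rinv) * (dg xi * (mA * (mp 0 * mp 1 * mp 1) * mA'))"
    unfolding mP_curvature dg_mult [symmetric] by (simp only: mult.assoc)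
  then have "curvq i j = rinv * rinv * rinv * (xi * ent (mA * (mp 0 * mp 1 * mp 1) * mA') i j)"
    using assms by (simp only: curvq_ent ent_dg_mult)
  also have "ent (mA * (mp 0 * mp 1 * mp 1) * mA') i j
      = (\<Sum>l\<in>idx. \<Sum>k\<in>idx. Aq i k * fq (\<lambda>\<theta>. basic_curv \<theta> k l) * As j l)"
    unfolding ent by (intro sum.cong refl) (simp only: basic_curv_fq)
  also have "xi * (\<Sum>l\<in>idx. \<Sum>k\<in>idx. Aq i k * fq (\<lambda>\<theta>. basic_curv \<theta> k l) * As j l)
      = (\<Sum>l\<in>idx. \<Sum>k\<in>idx. tn (\<lambda>_. xi_sl * Amat i k * sl_adj (Amat j l)) (\<lambda>\<theta>. basic_curv \<theta> k l))"
    unfolding sum_distrib_left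
  proof (intro sum.cong refl)
    fix k l assume "k \<in> idx" "l \<in> idx"
    then show "xi * (Aq i k * fq (\<lambda>\<theta>. basic_curv \<theta> k l) * As j l)
        = tn (\<lambda>_. xi_sl * Amat i k * sl_adj (Amat j l)) (\<lambda>\<theta>. basic_curv \<theta> k l)"
      using assms by (simp add: xi_tn Aq_def As_def fq_def tn_mult mult.assoc)
  qed
  also have "\<dots> = (\<Sum>k\<in>idx. \<Sum>l\<in>idx. tn (\<lambda>_. xi_sl * Amat i k * sl_adj (Amat j l)) (\<lambda>\<theta>. basic_curv \<theta> k l))"
    by (rule sum.swap)
  finally show ?thesis .
qed

lemma curv_E_eq:
  assumes "i \<in> idx" "j \<in> idx"
  shows "E_eq \<theta> (curv \<theta> i j) (rhoinv ^ 3 * (\<Sum>k\<in>idx. \<Sum>l\<in>idx.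
     ten (xi_sl * Amat i k * sl_adj (Amat j l)) (basic_curv \<theta> k l)))"
  using curvq_tn[OF assms]
  unfolding curvq.abs_eq rinv_def fam_abs fam.abs_eq_iff
  by (simp add: power3_eq_cube)

text \<open>Encodes the pair (k, l) as r = 4 (k - 1) + (l - 1), since \<open>hodge_E\<close> sums
  over an initial segment of the naturals.\<close>

lemma sum_idx_idx: "(\<Sum>k\<in>idx. \<Sum>l\<in>idx. f k l) = (\<Sum>r<16. f (r div 4 + 1) (r mod 4 + 1) :: eelem)"
proof -
  have "{..<1::nat} = {0}"
    by auto
  then show ?thesis
    by (simp add: sum_idx lessThan_nat_numeral add_ac)
qed

lemma ten_selfdual:
  assumes "hodge s \<omega> - \<omega> \<in> sphere_ideal"
  shows "E_eq \<theta> (ten a \<omega>) (ten a (hodge s \<omega>))"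
proof -
  have "E_eq \<theta> (ten a (csc 1 \<omega> + (hodge s \<omega> - \<omega>))) (csc 1 (ten a \<omega>) + 0)"
    by (rule E_eq_trans[OF ten_add_right]) (intro E_eq_add E_eq_refl ten_ideal_right assms)
  then show ?thesis
    by (simp add: E_eq_sym)
qed

theorem proposition5p2:
  fixes \<theta> :: real and s :: complex
  assumes orientation: "s = 1 \<or> s = - 1"
    and basic: "basic_curv_selfdual \<theta> s"
  shows "(\<forall>\<psi>. P_section \<theta> \<psi> \<longrightarrow>
            (\<forall>i\<in>{1..4}. E_eq \<theta> (nabla \<theta> (nabla \<theta> \<psi>) i) (\<Sum>l=1..4. curv \<theta> i l * \<psi> l)))
       \<and> (\<forall>i\<in>{1..4}. \<forall>l\<in>{1..4}. hodge_E \<theta> s (curv \<theta> i l) (curv \<theta> i l))"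
proof (intro conjI allI impI ballI)
  fix \<psi> i
  assume "P_section \<theta> \<psi>" "i \<in> {1..4::nat}"
  then show "E_eq \<theta> (nabla \<theta> (nabla \<theta> \<psi>) i) (\<Sum>l=1..4. curv \<theta> i l * \<psi> l)"
    by (rule nabla_nabla)
next
  fix i j :: nat
  assume "i \<in> {1..4}" "j \<in> {1..4}"
  then have ij: "i \<in> idx" "j \<in> idx"
    by (simp_all only: idx_def)
  define a where "a r = xi_sl * Amat i (r div 4 + 1) * sl_adj (Amat j (r mod 4 + 1))" for r
  define \<omega> where "\<omega> r = basic_curv \<theta> (r div 4 + 1) (r mod 4 + 1)" for r
  have 1: "E_eq \<theta> (curv \<theta> i j) (rhoinv ^ 3 * (\<Sum>r<16. ten (a r) (\<omega> r)))"
    using curv_E_eq[OF ij] unfolding sum_idx_idx a_def \<omega>_def .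
  have "hodge s (\<omega> r) - \<omega> r \<in> sphere_ideal" if "r < 16" for r
  proof -
    have "r div 4 < 4" "r mod 4 < 4"
      using that by simp_all
    then have "r div 4 + 1 \<in> {1..4}" "r mod 4 + 1 \<in> {1..4}"
      unfolding atLeastAtMost_iff by linarith+
    then show ?thesis
      using basic unfolding basic_curv_selfdual_def \<omega>_def by blast
  qed
  then have "E_eq \<theta> (rhoinv ^ 3 * (\<Sum>r<16. ten (a r) (\<omega> r))) (rhoinv ^ 3 * (\<Sum>r<16. ten (a r) (hodge s (\<omega> r))))"
    by (intro E_eq_mult E_eq_refl E_eq_sum ten_selfdual) simp
  \<comment> \<open>The witnesses are the power 3 of \<open>rhoinv\<close>, n = 16, and the tensors
    formed from \<open>a\<close> and \<open>\<omega>\<close>.\<close>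
  with 1 show "hodge_E \<theta> s (curv \<theta> i j) (curv \<theta> i j)"
    unfolding hodge_E_def by (blast intro: E_eq_trans)
qed

end
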